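(* Fix $K\ge1$ and assume the setting in the context, with $|a_{ij}(x)|\le\kappa_\gamma/(1+|i-j|^\gamma)$ for all $x,i,j$ for some $\gamma>3/2$, and the H\"older condition for some $\alpha>1/2$ (with $\alpha\le1$) and $\beta>(2-\alpha/2+p)\vee(\tfrac72-\alpha/2)\vee(3-\alpha)$, where $p\ge0$. Let $w=y-x'$ and $w'=G(t)^{1/2}(y-x')$. Then there is $c_1=c_1(p)$, not depending on $K$, such that for all $j\le K$, $t>0$ and $x\in\mathbb{R}^K$, $$\int|w'_j|^{2p}Q_K(w',\widetilde A(y,t))\,dw'\le c_1,$$ and $$\int|w_j|^{2p}Q_K(w,A(y,t))\,dw\le c_1\frac{t^p}{(1+\lambda_jt)^p}\le c_1t^p.$$
   Context: Constants $0<\Lambda_0\le\Lambda_1$, $\kappa_\lambda>0$, $\kappa_\beta,\kappa_\gamma$; $0<\lambda_1\le\dots\le\lambda_K$ with $\kappa_\lambda i^2\le\lambda_i\le\kappa_\lambda^{-1}i^2$. $a:\mathbb{R}^K\to$ symmetric $K\times K$ matrices with $\Lambda_0|v|^2\le\langle a(x)v,v\rangle\le\Lambda_1|v|^2$ and (H\"older condition) $|a_{ij}(y+he_k)-a_{ij}(y)|\le\kappa_\beta|h|^\alpha k^{-\beta}$ for all $i,j,k\le K$, $y\in\mathbb{R}^K$, $h\in\mathbb{R}$. $a_{ij}(y,t)=a_{ij}(y)\int_0^te^{-(\lambda_i+\lambda_j)s}ds$, $A(y,t)=a(y,t)^{-1}$; $g(t)=\mathrm{diag}((1-e^{-2\lambda_it})/(2\lambda_i))$,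 $G(t)=g(t)^{-1}$, $\widetilde A(y,t)=g(t)^{1/2}A(y,t)g(t)^{1/2}$; $x'_i=e^{-\lambda_it}x_i$; $Q_K(w,C)=(2\pi)^{-K/2}(\det C)^{1/2}e^{-\langle w,Cw\rangle/2}$. In the integrals, $y$ is regarded as a function of the integration variable via $y=x'+w=x'+g(t)^{1/2}w'$. *)

theory Defs
  imports "HOL-Analysis.Analysis"
begin

text \<open>Vectors in R^K are functions nat => real indexed by {1..K};
  K x K matrices are functions nat => nat => real indexed by {1..K} x {1..K}.\<close>

definition idx :: "nat \<Rightarrow> nat set" where
  "idx K = {1..K}"

definition qform :: "nat \<Rightarrow> (nat \<Rightarrow> nat \<Rightarrow> real) \<Rightarrow> (nat \<Rightarrow> real) \<Rightarrow> real" where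
  "qform K C v = (\<Sum>i\<in>idx K. \<Sum>j\<in>idx K. v i * C i j * v j)"

definition detK :: "nat \<Rightarrow> (nat \<Rightarrow> nat \<Rightarrow> real) \<Rightarrow> real" where
  "detK K M = (\<Sum>q | q permutes idx K. of_int (sign q) * (\<Prod>i\<in>idx K. M i (q i)))"

definition invK :: "nat \<Rightarrow> (nat \<Rightarrow> nat \<Rightarrow> real) \<Rightarrow> (nat \<Rightarrow> nat \<Rightarrow> real)" where
  "invK K M = (THE B. (\<forall>i\<in>idx K. \<forall>j\<in>idx K.
        (\<Sum>k\<in>idx K. B i k * M k j) = (if i = j then 1 else 0)) \<and>
      (\<forall>i j. i \<notin> idx K \<or> j \<notin> idx K \<longrightarrow> B i j = 0))"

definition QK :: "nat \<Rightarrow> (nat \<Rightarrow> real) \<Rightarrow> (nat \<Rightarrow> nat \<Rightarrow> real) \<Rightarrow> real" where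
  "QK K w C = (2 * pi) powr (- real K / 2) * sqrt (detK K C) * exp (- qform K C w / 2)"

definition a_t :: "(nat \<Rightarrow> real) \<Rightarrow> ((nat \<Rightarrow> real) \<Rightarrow> nat \<Rightarrow> nat \<Rightarrow> real)
    \<Rightarrow> (nat \<Rightarrow> real) \<Rightarrow> real \<Rightarrow> nat \<Rightarrow> nat \<Rightarrow> real" where
  "a_t lam a y t i j = a y i j * integral {0..t} (\<lambda>s. exp (- (lam i + lam j) * s))"

definition A_t :: "nat \<Rightarrow> (nat \<Rightarrow> real) \<Rightarrow> ((nat \<Rightarrow> real) \<Rightarrow> nat \<Rightarrow> nat \<Rightarrow> real)
    \<Rightarrow> (nat \<Rightarrow> real) \<Rightarrow> real \<Rightarrow> nat \<Rightarrow> nat \<Rightarrow> real" where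
  "A_t K lam a y t = invK K (a_t lam a y t)"

definition gdiag :: "(nat \<Rightarrow> real) \<Rightarrow> real \<Rightarrow> nat \<Rightarrow> real" where
  "gdiag lam t i = (1 - exp (- 2 * lam i * t)) / (2 * lam i)"

definition At_tilde :: "nat \<Rightarrow> (nat \<Rightarrow> real) \<Rightarrow> ((nat \<Rightarrow> real) \<Rightarrow> nat \<Rightarrow> nat \<Rightarrow> real)
    \<Rightarrow> (nat \<Rightarrow> real) \<Rightarrow> real \<Rightarrow> nat \<Rightarrow> nat \<Rightarrow> real" where
  "At_tilde K lam a y t i j = sqrt (gdiag lam t i) * A_t K lam a y t i j * sqrt (gdiag lam t j)"

definition xprime :: "(nat \<Rightarrow> real) \<Rightarrow> real \<Rightarrow> (nat \<Rightarrow> real) \<Rightarrow> nat \<Rightarrow> real" where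
  "xprime lam t x i = exp (- lam i * t) * x i"

definition setting :: "nat \<Rightarrow> real \<Rightarrow> real \<Rightarrow> real \<Rightarrow> real \<Rightarrow> real \<Rightarrow> real
    \<Rightarrow> (nat \<Rightarrow> real) \<Rightarrow> ((nat \<Rightarrow> real) \<Rightarrow> nat \<Rightarrow> nat \<Rightarrow> real) \<Rightarrow> bool" where
  "setting K \<Lambda>0 \<Lambda>1 kappa_l kappa_b \<alpha> \<beta> lam a \<longleftrightarrow>
     0 < \<Lambda>0 \<and> \<Lambda>0 \<le> \<Lambda>1 \<and> 0 < kappa_l \<and>
     0 < lam 1 \<and> (\<forall>i\<in>idx K. \<forall>j\<in>idx K. i \<le> j \<longrightarrow> lam i \<le> lam j) \<and>
     (\<forall>i\<in>idx K. kappa_l * (real i)\<^sup>2 \<le> lam i \<and> lam i \<le> (real i)\<^sup>2 / kappa_l) \<and>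
     (\<forall>y. \<forall>i\<in>idx K. \<forall>j\<in>idx K. a y i j = a y j i) \<and>
     (\<forall>y v. \<Lambda>0 * (\<Sum>i\<in>idx K. (v i)\<^sup>2) \<le> qform K (a y) v \<and>
            qform K (a y) v \<le> \<Lambda>1 * (\<Sum>i\<in>idx K. (v i)\<^sup>2)) \<and>
     (\<forall>y h. \<forall>i\<in>idx K. \<forall>j\<in>idx K. \<forall>k\<in>idx K.
        \<bar>a (y(k := y k + h)) i j - a y i j\<bar> \<le> kappa_b * \<bar>h\<bar> powr \<alpha> * real k powr (- \<beta>))"

end

theory Submission
  imports Defs "HOL-Probability.Distributions"
begin

text \<open>In the scaled coordinates \<open>w'\<close> the integrand is a Gaussian density whose covariance
  has spectrum in \<open>[\<Lambda>0, \<Lambda>1]\<close> but depends on the integration variable. The coordinates are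
  integrated out one at a time, in the order \<open>K, K - 1, \<dots>\<close>, with \<open>j\<close> kept until the end.
  When it is the turn of coordinate \<open>m\<close>, at most \<open>m + 1\<close> coordinates are left.
  If \<open>\<bar>w' m\<bar> \<le> m powr (3/4)\<close>, then setting \<open>w' m\<close> to \<open>0\<close> inside the covariance changes it by a
  factor \<open>1 + e m\<close> in the order of quadratic forms, where \<open>e m = O(m powr (-9/4))\<close> by the Hoelder
  condition and \<open>\<beta> > 7/2 - \<alpha>/2\<close>. This costs a factor \<open>(1 + e m) ^ (m + 1)\<close> and the scalar
  inflation \<open>1 + e m\<close> of the covariance, and afterwards the marginal in \<open>w' m\<close> is exact.
  If \<open>\<bar>w' m\<bar> > m powr (3/4)\<close>, the crude bound \<open>C ^ m * exp (- q * m powr (3/2))\<close> suffices.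
  The product of the factors converges and the tails are summable, uniformly in \<open>K\<close>. The second
  estimate is the first one after the substitution \<open>w = g(t)\<^sup>1\<^sup>/\<^sup>2 w'\<close>.\<close>

section \<open>Schur complements and Gaussian densities\<close>

text \<open>As the covariance depends on the integration variable, the integrand is not a density
  and no marginal is exact; freezing one coordinate at a time restores exactness at a price, and
  constants free of \<open>K\<close> require summable prices. The exponent 3/4 is a compromise: with
  radius \<open>m powr r\<close> the tail must beat a constant to the power \<open>m\<close>, so r >
  1/2, whereas a smaller r gives a smaller perturbation. In the original coordinates a unit of
  \<open>w' m\<close> has length O(1/m), so the radius \<open>m powr (3/4)\<close> changes each
  entry of \<open>a\<close> by O(m^(-\<alpha>/4 - \<beta>)), which is O(m^(-13/4)). Passing from
  entries to quadratic forms in at most \<open>m + 1\<close> variables loses one power of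
  \<open>m\<close>, and the exponent of the determinant factor loses another; 13/4 - 2 = 5/4 still
  exceeds 1. Elimination along a list suits this: the order of quadratic forms controls each pivot,
  and dropping the last index is marginalisation. Covariances are compared rather than precision
  matrices because a marginal covariance is a submatrix.\<close>

definition qf :: "'a set \<Rightarrow> ('a \<Rightarrow> 'a \<Rightarrow> real) \<Rightarrow> ('a \<Rightarrow> real) \<Rightarrow> real" where
  "qf S B v = (\<Sum>i\<in>S. \<Sum>j\<in>S. v i * B i j * v j)"

definition pos_def :: "'a set \<Rightarrow> ('a \<Rightarrow> 'a \<Rightarrow> real) \<Rightarrow> bool" where
  "pos_def S B \<longleftrightarrow> (\<forall>i\<in>S. \<forall>j\<in>S. B i j = B j i) \<and> (\<forall>v. (\<exists>i\<in>S. v i \<noteq> 0) \<longrightarrow> 0 < qf S B v)"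

lemma pos_defI:
  assumes "\<And>i j. i \<in> S \<Longrightarrow> j \<in> S \<Longrightarrow> B i j = B j i"
    and "\<And>v i. i \<in> S \<Longrightarrow> v i \<noteq> 0 \<Longrightarrow> 0 < qf S B v"
  shows "pos_def S B"
  using assms unfolding pos_def_def by blast

lemma pos_def_sym: "pos_def S B \<Longrightarrow> i \<in> S \<Longrightarrow> j \<in> S \<Longrightarrow> B i j = B j i"
  unfolding pos_def_def by blast

lemma pos_def_pos: "pos_def S B \<Longrightarrow> i \<in> S \<Longrightarrow> v i \<noteq> 0 \<Longrightarrow> 0 < qf S B v"
  unfolding pos_def_def by blast

text \<open>For a covariance \<open>B\<close> this is the covariance of the other coordinates
  conditioned on coordinate \<open>i\<close>; the marginal covariance, by contrast, is a mere
  restriction of \<open>B\<close>.\<close>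

definition schur :: "'a \<Rightarrow> ('a \<Rightarrow> 'a \<Rightarrow> real) \<Rightarrow> 'a \<Rightarrow> 'a \<Rightarrow> real" where
  "schur i B = (\<lambda>k l. B k l - B k i * B i l / B i i)"

lemma qf_cong: "(\<And>i. i \<in> S \<Longrightarrow> v i = v' i) \<Longrightarrow> qf S B v = qf S B v'"
  by (simp add: qf_def)

lemma qf_scale: "qf S (\<lambda>k l. c * B k l) v = c * qf S B v"
  unfolding qf_def sum_distrib_left by (simp only: mult_ac)

lemma qf_subset:
  assumes "T \<subseteq> S" "finite S"
  shows "qf T B v = qf S B (\<lambda>i. if i \<in> T then v i else 0)"
proof -
  let ?u = "\<lambda>i. if i \<in> T then v i else 0"
  have "qf S B ?u = (\<Sum>i\<in>T. \<Sum>j\<in>S. ?u i * B i j * ?u j)"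
    unfolding qf_def by (rule sum.mono_neutral_right) (use assms in auto)
  also have "\<dots> = (\<Sum>i\<in>T. \<Sum>j\<in>T. ?u i * B i j * ?u j)"
    by (intro sum.cong refl sum.mono_neutral_right) (use assms in auto)
  also have "\<dots> = qf T B v"
    unfolding qf_def by (intro sum.cong refl) auto
  finally show ?thesis by simp
qed

lemma qf_insert:
  assumes "finite T" "i \<notin> T" "\<forall>k\<in>insert i T. \<forall>l\<in>insert i T. B k l = B l k"
  shows "qf (insert i T) B v = B i i * (v i)\<^sup>2 + 2 * v i * (\<Sum>k\<in>T. B i k * v k) + qf T B v"
proof -
  have "(\<Sum>k\<in>T. v k * B k i * v i) = (\<Sum>k\<in>T. v i * B i k * v k)"
  proof (rule sum.cong)
    fix k assume "k \<in> T"
    then have "B k i = B i k" using assms(3) by blast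
    then show "v k * B k i * v i = v i * B i k * v k" by simp
  qed simp
  then show ?thesis
    using assms(1,2)
    by (simp add: qf_def sum.distrib sum_distrib_left power2_eq_square algebra_simps)
qed

lemma qf_schur:
  assumes "finite T" "\<forall>k\<in>insert i T. \<forall>l\<in>insert i T. B k l = B l k"
  shows "qf T (schur i B) v = qf T B v - (\<Sum>k\<in>T. B i k * v k)\<^sup>2 / B i i"
proof -
  have "qf T (schur i B) v
      = (\<Sum>k\<in>T. \<Sum>l\<in>T. v k * B k l * v l - (B i k * v k) * (B i l * v l) / B i i)"
  proof -
    have "B k i = B i k" if "k \<in> T" for k using assms(2) that by blast
    then show ?thesis
      unfolding qf_def schur_def by (intro sum.cong refl) (simp add: algebra_simps)
  qed
  also have "\<dots> = qf T B v - (\<Sum>k\<in>T. \<Sum>l\<in>T. (B i k * v k) * (B i l * v l)) / B i i"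
    by (simp add: qf_def sum_subtractf sum_divide_distrib)
  also have "(\<Sum>k\<in>T. \<Sum>l\<in>T. (B i k * v k) * (B i l * v l)) = (\<Sum>k\<in>T. B i k * v k)\<^sup>2"
    by (simp add: power2_eq_square sum_product)
  finally show ?thesis .
qed

lemma qf_complete_square:
  assumes "finite T" "i \<notin> T" "\<forall>k\<in>insert i T. \<forall>l\<in>insert i T. B k l = B l k" "B i i > 0"
  shows "qf (insert i T) B v
    = B i i * (v i + (\<Sum>k\<in>T. B i k * v k) / B i i)\<^sup>2 + qf T (schur i B) v"
  using assms(4)
  by (simp add: qf_insert[OF assms(1-3)] qf_schur[OF assms(1,3)] power2_eq_square field_simps)

lemma qf_unit:
  assumes "finite S" "i \<in> S"
  shows "qf S B (\<lambda>k. if k = i then 1 else 0) = B i i"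
proof -
  have "qf S B (\<lambda>k. if k = i then 1 else 0) = (\<Sum>k\<in>S. \<Sum>l\<in>S. if l = i then (if k = i then B k l else 0) else 0)"
    unfolding qf_def by (intro sum.cong) auto
  then show ?thesis using assms by (simp add: sum.delta)
qed

lemma pos_def_diag:
  assumes "pos_def S B" "i \<in> S" "finite S"
  shows "B i i > 0"
proof -
  have "0 < qf S B (\<lambda>k. if k = i then 1 else 0)"
    by (rule pos_def_pos[OF assms(1,2)]) simp
  then show ?thesis using assms by (simp add: qf_unit)
qed

lemma pos_def_nonneg: "pos_def S B \<Longrightarrow> 0 \<le> qf S B v"
proof (cases "\<exists>i\<in>S. v i \<noteq> 0")
  case True
  then obtain i where "i \<in> S" "v i \<noteq> 0" by blast
  moreover assume "pos_def S B"
  ultimately show ?thesis using pos_def_pos[of S B i v] by linarith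
next
  case False
  then show ?thesis by (simp add: qf_def)
qed

text \<open>Completing the square shows that the Schur form is the minimum of the full form over
  coordinate \<open>i\<close>; the value inserted here is the minimiser. Positivity, monotonicity
  and lower bounds are inherited through this.\<close>

lemma qf_schur_attained:
  assumes "pos_def (insert i T) B" "finite T" "i \<notin> T"
  shows "qf T (schur i B) v = qf (insert i T) B (v(i := - (\<Sum>k\<in>T. B i k * v k) / B i i))"
proof -
  let ?v = "v(i := - (\<Sum>k\<in>T. B i k * v k) / B i i)"
  have s: "(\<Sum>k\<in>T. B i k * ?v k) = (\<Sum>k\<in>T. B i k * v k)"
    using assms(3) by (intro sum.cong) auto
  have pos: "B i i > 0" using pos_def_diag[OF assms(1), of i] assms(2) by simp
  have sym: "\<forall>k\<in>insert i T. \<forall>l\<in>insert i T. B k l = B l k"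
    using pos_def_sym[OF assms(1)] by blast
  have "qf T (schur i B) ?v = qf T (schur i B) v"
    using assms(3) by (intro qf_cong) auto
  then show ?thesis
    unfolding qf_complete_square[OF assms(2,3) sym pos, of ?v] s by simp
qed

lemma qf_schur_le:
  assumes "pos_def (insert i T) B" "finite T" "i \<notin> T"
  shows "qf T (schur i B) v \<le> qf (insert i T) B v"
proof -
  have pos: "B i i > 0" using pos_def_diag[OF assms(1), of i] assms(2) by simp
  have sym: "\<forall>k\<in>insert i T. \<forall>l\<in>insert i T. B k l = B l k"
    using pos_def_sym[OF assms(1)] by blast
  show ?thesis
    unfolding qf_complete_square[OF assms(2,3) sym pos, of v]
    using mult_nonneg_nonneg[OF less_imp_le[OF pos] zero_le_power2] by simp
qed

lemma pos_def_schur: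
  assumes "pos_def (insert i T) B" "finite T" "i \<notin> T"
  shows "pos_def T (schur i B)"
proof -
  show ?thesis
  proof (rule pos_defI)
    fix v :: "'a \<Rightarrow> real" and k assume "k \<in> T" "v k \<noteq> 0"
    then show "0 < qf T (schur i B) v"
      unfolding qf_schur_attained[OF assms]
      using assms(3) by (intro pos_def_pos[OF assms(1), of k]) auto
  next
    fix k l assume "k \<in> T" "l \<in> T"
    then show "schur i B k l = schur i B l k"
      using pos_def_sym[OF assms(1), of k l] pos_def_sym[OF assms(1), of i k]
        pos_def_sym[OF assms(1), of i l]
      by (simp add: schur_def)
  qed
qed

text \<open>The minimum of a larger function is larger: the minimiser for \<open>B'\<close> is a
  competitor for \<open>B\<close>.\<close>

lemma schur_mono:
  assumes "pos_def (insert i T) B" "pos_def (insert i T) B'" "finite T" "i \<notin> T"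
    and le: "\<And>v. qf (insert i T) B v \<le> qf (insert i T) B' v"
  shows "qf T (schur i B) v \<le> qf T (schur i B') v"
proof -
  let ?v = "v(i := - (\<Sum>k\<in>T. B' i k * v k) / B' i i)"
  have "qf T (schur i B) v = qf T (schur i B) ?v"
    using assms(4) by (intro qf_cong) auto
  also have "\<dots> \<le> qf (insert i T) B ?v" by (rule qf_schur_le[OF assms(1,3,4)])
  also have "\<dots> \<le> qf (insert i T) B' ?v" by (rule le)
  also have "\<dots> = qf T (schur i B') v" by (rule qf_schur_attained[OF assms(2-4), symmetric])
  finally show ?thesis .
qed

text \<open>Determinant, inverse quadratic form and centred Gaussian density with covariance \<open>B\<close>, all by
  Gaussian elimination along a list of indices.\<close>

primrec gdet :: "'a list \<Rightarrow> ('a \<Rightarrow> 'a \<Rightarrow> real) \<Rightarrow> real" where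
  "gdet [] B = 1"
| "gdet (i # L) B = B i i * gdet L (schur i B)"

primrec gform :: "'a list \<Rightarrow> ('a \<Rightarrow> real) \<Rightarrow> ('a \<Rightarrow> 'a \<Rightarrow> real) \<Rightarrow> real" where
  "gform [] w B = 0"
| "gform (i # L) w B = (w i)\<^sup>2 / B i i + gform L (\<lambda>k. w k - B k i / B i i * w i) (schur i B)"

primrec gauss :: "'a list \<Rightarrow> ('a \<Rightarrow> real) \<Rightarrow> ('a \<Rightarrow> 'a \<Rightarrow> real) \<Rightarrow> real" where
  "gauss [] w B = 1"
| "gauss (i # L) w B = normal_density 0 (sqrt (B i i)) (w i)
     * gauss L (\<lambda>k. w k - B k i / B i i * w i) (schur i B)"

lemma pos_def_ConsD:
  assumes "pos_def (set (i # L)) B" "distinct (i # L)"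
  shows "B i i > 0" "pos_def (set L) (schur i B)"
  using assms pos_def_diag[of "set (i # L)" B i] pos_def_schur[of i "set L" B] by auto

lemma gdet_pos: "pos_def (set L) B \<Longrightarrow> distinct L \<Longrightarrow> gdet L B > 0"
proof (induction L arbitrary: B)
  case (Cons i L)
  then show ?case using pos_def_ConsD[OF Cons.prems] by simp
qed simp

text \<open>The pivots are compared one by one: the first is the form at a unit vector, the later
  ones are handled by \<open>schur_mono\<close>.\<close>

lemma gdet_mono:
  assumes "pos_def (set L) B" "pos_def (set L) B'" "distinct L"
    and "\<And>v. qf (set L) B v \<le> qf (set L) B' v"
  shows "gdet L B \<le> gdet L B'"
  using assms
proof (induction L arbitrary: B B')
  case (Cons i L)
  note d = pos_def_ConsD[OF Cons.prems(1,3)] pos_def_ConsD[OF Cons.prems(2,3)]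
  have "qf (set (i # L)) C (\<lambda>k. if k = i then 1 else 0) = C i i" for C
    by (rule qf_unit) auto
  from Cons.prems(4)[of "\<lambda>k. if k = i then 1 else 0", unfolded this]
  have le: "B i i \<le> B' i i" .
  have i: "i \<notin> set L" "distinct L" using Cons.prems(3) by auto
  note p = Cons.prems(1,2,4)[unfolded list.set(2)]
  have "gdet L (schur i B) \<le> gdet L (schur i B')"
    by (rule Cons.IH[OF d(2) d(4) i(2)]) (rule schur_mono[OF p(1,2) finite_set i(1) p(3)])
  then show ?case
    unfolding gdet.simps
    using le d(1,3) gdet_pos[OF d(2) i(2)] by (intro mult_mono) auto
qed simp

lemma schur_scale: "c \<noteq> 0 \<Longrightarrow> schur i (\<lambda>k l. c * B k l) = (\<lambda>k l. c * schur i B k l)"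
  by (simp add: schur_def fun_eq_iff right_diff_distrib)

lemma gdet_scale: "c \<noteq> 0 \<Longrightarrow> gdet L (\<lambda>k l. c * B k l) = c ^ length L * gdet L B"
  by (induction L arbitrary: B) (simp_all add: schur_scale)

lemma normal_density_sqrt:
  "b > 0 \<Longrightarrow> normal_density 0 (sqrt b) x = exp (- (x\<^sup>2 / b) / 2) / sqrt (2 * pi * b)"
  by (simp add: normal_density_def)

lemma gauss_eq:
  assumes "pos_def (set L) B" "distinct L"
  shows "gauss L w B = exp (- gform L w B / 2) / sqrt ((2 * pi) ^ length L * gdet L B)"
  using assms
proof (induction L arbitrary: w B)
  case (Cons i L)
  note d = pos_def_ConsD[OF Cons.prems]
  let ?f = "gform L (\<lambda>k. w k - B k i / B i i * w i) (schur i B)"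
  have "gauss (i # L) w B = exp (- ((w i)\<^sup>2 / B i i) / 2) / sqrt (2 * pi * B i i)
    * (exp (- ?f / 2) / sqrt ((2 * pi) ^ length L * gdet L (schur i B)))"
    using Cons.IH[OF d(2)] Cons.prems(2) d(1) by (simp add: normal_density_sqrt)
  also have "\<dots> = exp (- ((w i)\<^sup>2 / B i i) / 2 + - ?f / 2)
    / sqrt (2 * pi * B i i * ((2 * pi) ^ length L * gdet L (schur i B)))"
    by (simp only: exp_add real_sqrt_mult times_divide_times_eq)
  also have "- ((w i)\<^sup>2 / B i i) / 2 + - ?f / 2 = - gform (i # L) w B / 2"
    by (simp add: add_divide_distrib)
  also have "2 * pi * B i i * ((2 * pi) ^ length L * gdet L (schur i B))
    = (2 * pi) ^ length (i # L) * gdet (i # L) B"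
    by simp
  finally show ?case .
qed simp

text \<open>Isolates \<open>v i\<close> in the function that \<open>gform\<close> maximises. The
  square vanishes at the maximum, and what remains is the recursion of \<open>gform\<close>.\<close>

lemma linear_minus_qf_split:
  assumes "pos_def (insert i T) B" "finite T" "i \<notin> T"
  shows "2 * (\<Sum>k\<in>insert i T. v k * w k) - qf (insert i T) B v
     = (w i)\<^sup>2 / B i i - B i i * (v i + (\<Sum>k\<in>T. B i k * v k) / B i i - w i / B i i)\<^sup>2
       + (2 * (\<Sum>k\<in>T. v k * (w k - B k i / B i i * w i)) - qf T (schur i B) v)"
proof -
  have pos: "B i i > 0" using pos_def_diag[OF assms(1), of i] assms(2) by simp
  have "(\<Sum>k\<in>T. v k * (w k - B k i / B i i * w i))
      = (\<Sum>k\<in>T. v k * w k - w i / B i i * (B i k * v k))"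
  proof (rule sum.cong)
    fix k assume "k \<in> T"
    then have "B k i = B i k" using pos_def_sym[OF assms(1), of k i] by simp
    then show "v k * (w k - B k i / B i i * w i) = v k * w k - w i / B i i * (B i k * v k)"
      by (simp add: algebra_simps)
  qed simp
  also have "\<dots> = (\<Sum>k\<in>T. v k * w k) - w i / B i i * (\<Sum>k\<in>T. B i k * v k)"
    by (simp add: sum_subtractf sum_distrib_left)
  finally have cross: "(\<Sum>k\<in>T. v k * (w k - B k i / B i i * w i))
    = (\<Sum>k\<in>T. v k * w k) - w i / B i i * (\<Sum>k\<in>T. B i k * v k)" .
  have square: "qf (insert i T) B v
    = B i i * (v i + (\<Sum>k\<in>T. B i k * v k) / B i i)\<^sup>2 + qf T (schur i B) v"
    using pos_def_sym[OF assms(1)] by (intro qf_complete_square assms(2,3) pos) blast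
  have key: "2 * (x * y + r) - (b * (x + z / b)\<^sup>2 + q)
    = y\<^sup>2 / b - b * (x + z / b - y / b)\<^sup>2 + (2 * (r - y / b * z) - q)" if "b > 0" for x y z r q b :: real
  proof -
    define s u where "s = z / b" and "u = y / b"
    with that have "z = b * s" "y = b * u" by auto
    with that show ?thesis by (simp add: power2_eq_square algebra_simps)
  qed
  show ?thesis
    unfolding cross square sum.insert[OF assms(2,3)] by (rule key[OF pos])
qed

text \<open>\<open>gform L w B\<close> is the maximum over \<open>v\<close> of \<open>2 \<langle>v, w\<rangle> - \<langle>v, B v\<rangle>\<close>; this makes it antimonotone
  in \<open>B\<close> and independent of the order of \<open>L\<close>.\<close>

lemma gform_ge:
  assumes "pos_def (set L) B" "distinct L"
  shows "2 * (\<Sum>k\<in>set L. v k * w k) - qf (set L) B v \<le> gform L w B"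
  using assms
proof (induction L arbitrary: w B)
  case Nil
  then show ?case by (simp add: qf_def)
next
  case (Cons i L)
  note d = pos_def_ConsD[OF Cons.prems]
  have "2 * (\<Sum>k\<in>set (i # L). v k * w k) - qf (set (i # L)) B v
    \<le> (w i)\<^sup>2 / B i i + (2 * (\<Sum>k\<in>set L. v k * (w k - B k i / B i i * w i)) - qf (set L) (schur i B) v)"
    using Cons.prems d(1) linear_minus_qf_split[of i "set L" B v w] by simp
  also have "\<dots> \<le> gform (i # L) w B"
    using Cons.IH[OF d(2)] Cons.prems(2) by simp
  finally show ?case .
qed

lemma gform_attained:
  assumes "pos_def (set L) B" "distinct L"
  shows "\<exists>v. gform L w B = 2 * (\<Sum>k\<in>set L. v k * w k) - qf (set L) B v"
  using assms
proof (induction L arbitrary: w B)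
  case Nil
  then show ?case by (simp add: qf_def)
next
  case (Cons i L)
  note d = pos_def_ConsD[OF Cons.prems]
  let ?w = "\<lambda>k. w k - B k i / B i i * w i"
  obtain v where v: "gform L ?w (schur i B) = 2 * (\<Sum>k\<in>set L. v k * ?w k) - qf (set L) (schur i B) v"
    using Cons.IH[OF d(2)] Cons.prems(2) by fastforce
  \<comment> \<open>Back substitution: the new entry at \<open>i\<close> annihilates the square in
    \<open>linear_minus_qf_split\<close>.\<close>
  define u where "u = v(i := w i / B i i - (\<Sum>k\<in>set L. B i k * v k) / B i i)"
  have u: "u k = v k" if "k \<in> set L" for k using that Cons.prems(2) by (auto simp: u_def)
  have "2 * (\<Sum>k\<in>set (i # L). u k * w k) - qf (set (i # L)) B u
    = (w i)\<^sup>2 / B i i - B i i * (u i + (\<Sum>k\<in>set L. B i k * u k) / B i i - w i / B i i)\<^sup>2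
       + (2 * (\<Sum>k\<in>set L. u k * ?w k) - qf (set L) (schur i B) u)"
    using Cons.prems linear_minus_qf_split[of i "set L" B u w] by simp
  also have "(\<Sum>k\<in>set L. B i k * u k) = (\<Sum>k\<in>set L. B i k * v k)" by (simp add: u)
  also have "(\<Sum>k\<in>set L. u k * ?w k) = (\<Sum>k\<in>set L. v k * ?w k)" by (simp add: u)
  also have "qf (set L) (schur i B) u = qf (set L) (schur i B) v" by (intro qf_cong u)
  also have "u i + (\<Sum>k\<in>set L. B i k * v k) / B i i - w i / B i i = 0"
    by (simp add: u_def)
  finally have "2 * (\<Sum>k\<in>set (i # L). u k * w k) - qf (set (i # L)) B u = gform (i # L) w B"
    by (simp only: gform.simps v) simp
  then show ?case by metis
qed

lemma gform_antimono:
  assumes "pos_def (set L) B" "pos_def (set L) B'" "distinct L"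
    and "\<And>v. qf (set L) B v \<le> qf (set L) B' v"
  shows "gform L w B' \<le> gform L w B"
proof -
  obtain v where "gform L w B' = 2 * (\<Sum>k\<in>set L. v k * w k) - qf (set L) B' v"
    using gform_attained[OF assms(2,3)] by blast
  with gform_ge[OF assms(1,3), of v w] assms(4)[of v] show ?thesis by linarith
qed

section \<open>Determinant and inverse of a positive definite matrix\<close>

text \<open>Stated over an arbitrary index set, since the comparison with \<open>gdet\<close>
  removes indices one at a time.\<close>

definition sdet :: "'a set \<Rightarrow> ('a \<Rightarrow> 'a \<Rightarrow> real) \<Rightarrow> real" where
  "sdet S M = (\<Sum>q | q permutes S. of_int (sign q) * (\<Prod>i\<in>S. M i (q i)))"

text \<open>Right multiplication by the transposition of \<open>i\<close> and \<open>k\<close> is a sign-reversing involution.\<close>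

lemma sdet_equal_rows:
  assumes "finite T" "i \<notin> T" "k \<in> T"
  shows "(\<Sum>q | q permutes insert i T. of_int (sign q) * (A k (q i) * (\<Prod>r\<in>T. A r (q r)))) = (0::real)"
proof -
  let ?f = "\<lambda>q. of_int (sign q) * (A k (q i) * (\<Prod>r\<in>T. A r (q r))) :: real"
  let ?P = "{q. q permutes insert i T}"
  let ?t = "Transposition.transpose i k"
  have tp: "?t permutes insert i T" using assms(3) by (intro permutes_swap_id) auto
  have "sum ?f ?P = sum (\<lambda>q. - ?f q) ?P"
  proof (rule sum.reindex_bij_witness[where i = "\<lambda>q. q \<circ> ?t" and j = "\<lambda>q. q \<circ> ?t"])
    fix q assume q: "q \<in> ?P"
    show "(q \<circ> ?t) \<circ> ?t = q" "(q \<circ> ?t) \<circ> ?t = q" by (simp_all add: comp_assoc)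
    show "q \<circ> ?t \<in> ?P" "q \<circ> ?t \<in> ?P" using q tp permutes_compose[of ?t _ q] by auto
    have perm: "permutation q" "permutation ?t"
      using q tp assms(1) by (auto intro: permutes_imp_permutation[of "insert i T"])
    have "i \<noteq> k" using assms by auto
    then have "sign (q \<circ> ?t) = - sign q"
      by (simp add: sign_compose[OF perm] sign_swap_id)
    \<comment> \<open>Row \<open>k\<close> stands at both positions \<open>i\<close> and
      \<open>k\<close>, so exchanging the two images leaves the product unchanged.\<close>
    moreover have "A k ((q \<circ> ?t) i) * (\<Prod>r\<in>T. A r ((q \<circ> ?t) r)) = A k (q i) * (\<Prod>r\<in>T. A r (q r))"
    proof -
      have "(\<Prod>r\<in>T - {k}. A r ((q \<circ> ?t) r)) = (\<Prod>r\<in>T - {k}. A r (q r))"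
        using assms(2) by (intro prod.cong) (auto simp: Transposition.transpose_def)
      then show ?thesis
        by (simp add: prod.remove[OF assms(1,3)])
    qed
    ultimately show "- ?f (q \<circ> ?t) = ?f q" by simp
  qed
  then show ?thesis by (simp add: sum_negf)
qed

text \<open>Replace row \<open>i\<close> of \<open>A\<close> by the combination with coefficients
  \<open>c\<close>, which is the unit row. Multilinearity and the vanishing for equal rows give one
  value of the new determinant, expansion along the unit row the other. This is Cramer's rule for a
  diagonal entry of the inverse.\<close>

lemma sdet_row_combination:
  assumes T: "finite T" "i \<notin> T"
    and comb: "\<And>l. l \<in> insert i T \<Longrightarrow> (\<Sum>k\<in>insert i T. c k * A k l) = (if l = i then 1 else 0)"
  shows "c i * sdet (insert i T) A = sdet T A"
proof -
  let ?P = "{q. q permutes insert i T}"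
  have fin: "finite ?P" using T(1) by (intro finite_permutations) simp
  let ?x = "\<Sum>q\<in>?P. of_int (sign q) * ((\<Sum>k\<in>insert i T. c k * A k (q i)) * (\<Prod>r\<in>T. A r (q r)))"
  have "?x = (\<Sum>q\<in>?P. \<Sum>k\<in>insert i T. c k * (of_int (sign q) * (A k (q i) * (\<Prod>r\<in>T. A r (q r)))))"
    by (simp only: sum_distrib_left sum_distrib_right mult_ac)
  also have "\<dots> = (\<Sum>k\<in>insert i T. c k * (\<Sum>q\<in>?P. of_int (sign q) * (A k (q i) * (\<Prod>r\<in>T. A r (q r)))))"
    by (subst sum.swap) (simp only: sum_distrib_left)
  also have "\<dots> = c i * (\<Sum>q\<in>?P. of_int (sign q) * (A i (q i) * (\<Prod>r\<in>T. A r (q r))))"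
    using T by (simp add: sdet_equal_rows)
  also have "\<dots> = c i * sdet (insert i T) A"
    using T by (simp add: sdet_def)
  finally have 1: "?x = c i * sdet (insert i T) A" .
  have "?x = (\<Sum>q\<in>?P. if q i = i then of_int (sign q) * (\<Prod>r\<in>T. A r (q r)) else 0)"
  proof (rule sum.cong)
    fix q assume "q \<in> ?P"
    then have "q i \<in> insert i T" using permutes_in_image[of q "insert i T" i] by blast
    then show "of_int (sign q) * ((\<Sum>k\<in>insert i T. c k * A k (q i)) * (\<Prod>r\<in>T. A r (q r)))
      = (if q i = i then of_int (sign q) * (\<Prod>r\<in>T. A r (q r)) else 0)"
      by (subst comb) auto
  qed simp
  also have "\<dots> = (\<Sum>q\<in>{q \<in> ?P. q i = i}. of_int (sign q) * (\<Prod>r\<in>T. A r (q r)))"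
    by (rule sum.inter_filter[OF fin, symmetric])
  also have "{q \<in> ?P. q i = i} = {q. q permutes T}"
  proof (intro equalityI subsetI)
    fix q assume "q \<in> {q \<in> ?P. q i = i}"
    then show "q \<in> {q. q permutes T}"
      using permutes_superset[of q "insert i T" T] T(2) by auto
  next
    fix q assume "q \<in> {q. q permutes T}"
    then show "q \<in> {q \<in> ?P. q i = i}"
      using T(2) by (auto intro: permutes_subset simp: permutes_not_in)
  qed
  finally show ?thesis using 1 by (simp add: sdet_def)
qed

text \<open>Block inversion: the inverse of a Schur complement is the corresponding block of the
  inverse. Hence the same \<open>A\<close> serves at every stage of the elimination.\<close>

lemma schur_inverse:
  assumes T: "finite T" "i \<notin> T" and pos: "B i i \<noteq> 0"
    and inv: "\<And>k l. k \<in> insert i T \<Longrightarrow> l \<in> insert i T \<Longrightarrow>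
      (\<Sum>m\<in>insert i T. B k m * A m l) = (if k = l then 1 else 0)"
    and kl: "k \<in> T" "l \<in> T"
  shows "(\<Sum>m\<in>T. schur i B k m * A m l) = (if k = l then 1 else 0)"
proof -
  have "(\<Sum>m\<in>T. schur i B k m * A m l)
      = (\<Sum>m\<in>T. B k m * A m l - B k i / B i i * (B i m * A m l))"
    by (intro sum.cong) (auto simp: schur_def algebra_simps)
  also have "\<dots> = (\<Sum>m\<in>T. B k m * A m l) - B k i / B i i * (\<Sum>m\<in>T. B i m * A m l)"
    by (simp add: sum_subtractf sum_distrib_left)
  also have "(\<Sum>m\<in>T. B k m * A m l) = (if k = l then 1 else 0) - B k i * A i l"
    using inv[of k l] kl T by simp
  also have "(\<Sum>m\<in>T. B i m * A m l) = - B i i * A i l"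
    using inv[of i l] kl T by (auto split: if_splits)
  finally show ?thesis using pos by simp
qed

text \<open>The pivot \<open>B i i\<close> is the diagonal entry of the inverse of \<open>A\<close>
  that turns \<open>sdet\<close> of \<open>A\<close> into that of its smaller block. This avoids the
  product formula for determinants.\<close>

lemma gdet_sdet_inverse:
  assumes "pos_def (set L) B" "distinct L"
    and "\<And>k l. k \<in> set L \<Longrightarrow> l \<in> set L \<Longrightarrow>
      (\<Sum>m\<in>set L. B k m * A m l) = (if k = l then 1 else 0)"
  shows "gdet L B * sdet (set L) A = 1"
  using assms
proof (induction L arbitrary: B)
  case Nil
  have "{q. q permutes ({} :: 'a set)} = {id}" by auto
  then show ?case by (simp add: sdet_def)
next
  case (Cons i L)
  note d = pos_def_ConsD[OF Cons.prems(1,2)]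
  have i: "i \<notin> set L" "distinct L" using Cons.prems(2) by auto
  note inv = Cons.prems(3)[unfolded list.set(2)]
  have "gdet L (schur i B) * sdet (set L) A = 1"
    using d(1) by (intro Cons.IH d i schur_inverse[OF finite_set i(1) _ inv]) auto
  moreover have "B i i * sdet (insert i (set L)) A = sdet (set L) A"
    by (intro sdet_row_combination[where c = "B i"] finite_set i(1)) (use inv[of i] in auto)
  moreover have "gdet (i # L) B * sdet (set (i # L)) A
    = gdet L (schur i B) * (B i i * sdet (insert i (set L)) A)"
    by simp
  ultimately show ?case by (simp only:)
qed

text \<open>Solve the Schur system for the other unknowns, then recover \<open>u i\<close> from row
  \<open>i\<close>.\<close>

lemma pos_def_solvable:
  assumes "finite S" "pos_def S B"
  shows "\<exists>u. \<forall>k\<in>S. (\<Sum>m\<in>S. B k m * u m) = w k"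
  using assms
proof (induction S arbitrary: B w)
  case (insert i T)
  have pos: "B i i > 0" using pos_def_diag[OF insert.prems, of i] insert.hyps by simp
  obtain u where u: "\<And>k. k \<in> T \<Longrightarrow> (\<Sum>m\<in>T. schur i B k m * u m) = w k - B k i / B i i * w i"
    using insert.IH[OF pos_def_schur[OF insert.prems insert.hyps], of "\<lambda>k. w k - B k i / B i i * w i"] by blast
  define s where "s = (\<Sum>m\<in>T. B i m * u m)"
  have uT: "(\<Sum>m\<in>T. B k m * u m) = w k - B k i / B i i * w i + B k i / B i i * s" if "k \<in> T" for k
  proof -
    have "(\<Sum>m\<in>T. schur i B k m * u m) = (\<Sum>m\<in>T. B k m * u m - B k i / B i i * (B i m * u m))"
      by (intro sum.cong) (auto simp: schur_def algebra_simps)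
    also have "\<dots> = (\<Sum>m\<in>T. B k m * u m) - B k i / B i i * s"
      by (simp add: s_def sum_subtractf sum_distrib_left)
    finally show ?thesis using u[OF that] by simp
  qed
  let ?u = "u(i := (w i - s) / B i i)"
  have eq: "(\<Sum>m\<in>insert i T. B k m * ?u m) = B k i * ((w i - s) / B i i) + (\<Sum>m\<in>T. B k m * u m)" for k
  proof -
    have "(\<Sum>m\<in>T. B k m * ?u m) = (\<Sum>m\<in>T. B k m * u m)"
      using insert.hyps by (intro sum.cong) auto
    then show ?thesis using insert.hyps by simp
  qed
  have "(\<Sum>m\<in>insert i T. B k m * ?u m) = w k" if "k \<in> insert i T" for k
  proof (cases "k = i")
    case True
    with pos show ?thesis unfolding eq by (simp add: s_def)
  next
    case False
    with that have "k \<in> T" by simp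
    then show ?thesis unfolding eq by (simp add: uT diff_divide_distrib right_diff_distrib)
  qed
  then show ?case by blast
qed simp

text \<open>The maximum of 2 <v,w> - <v,Bv> is attained at v = A w, with value <w,Aw>. The upper
  bound follows from nonnegativity of the form of \<open>B\<close> at the difference between a
  maximiser and this point.\<close>

lemma gform_eq_qf_inverse:
  assumes B: "pos_def (set L) B" "distinct L"
    and inv: "\<And>k l. k \<in> set L \<Longrightarrow> l \<in> set L \<Longrightarrow>
      (\<Sum>m\<in>set L. B k m * A m l) = (if k = l then 1 else 0)"
  shows "gform L w B = qf (set L) A w"
proof -
  let ?S = "set L"
  define u where "u k = (\<Sum>l\<in>?S. A k l * w l)" for k
  have Bu: "(\<Sum>m\<in>?S. B k m * u m) = w k" if "k \<in> ?S" for k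
  proof -
    have "(\<Sum>m\<in>?S. B k m * u m) = (\<Sum>l\<in>?S. (\<Sum>m\<in>?S. B k m * A m l) * w l)"
      unfolding u_def sum_distrib_left sum_distrib_right
      by (subst sum.swap) (simp only: mult_ac)
    also have "\<dots> = (\<Sum>l\<in>?S. if k = l then w l else 0)"
      using that by (intro sum.cong) (auto simp: inv)
    finally show ?thesis using that by simp
  qed
  have uw: "(\<Sum>k\<in>?S. u k * w k) = qf ?S A w"
    unfolding qf_def u_def sum_distrib_right by (simp only: mult_ac)
  have qf_eq: "qf ?S B v = (\<Sum>k\<in>?S. v k * (\<Sum>m\<in>?S. B k m * v m))" for v
    unfolding qf_def sum_distrib_left by (simp only: mult_ac)
  have Buu: "qf ?S B u = qf ?S A w"
    unfolding qf_eq using Bu by (simp add: uw[symmetric])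
  have lower: "qf ?S A w \<le> gform L w B"
    using gform_ge[OF B, of u w] by (simp add: uw Buu)
  obtain v where v: "gform L w B = 2 * (\<Sum>k\<in>?S. v k * w k) - qf ?S B v"
    using gform_attained[OF B] by blast
  have "0 \<le> qf ?S B (\<lambda>k. v k - u k)" by (rule pos_def_nonneg[OF B(1)])
  also have "\<dots> = qf ?S B v - (\<Sum>k\<in>?S. v k * w k) - (\<Sum>k\<in>?S. u k * (\<Sum>m\<in>?S. B k m * v m)) + qf ?S B u"
    unfolding qf_eq using Bu
    by (simp add: sum_subtractf left_diff_distrib right_diff_distrib)
  also have "(\<Sum>k\<in>?S. u k * (\<Sum>m\<in>?S. B k m * v m)) = (\<Sum>m\<in>?S. v m * (\<Sum>k\<in>?S. B m k * u k))"
    unfolding sum_distrib_left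
    by (subst sum.swap) (intro sum.cong refl, simp add: pos_def_sym[OF B(1)])
  also have "\<dots> = (\<Sum>k\<in>?S. v k * w k)"
    using Bu by simp
  finally show ?thesis using v Buu lower by simp
qed

section \<open>The density \<open>QK\<close>, given by its precision matrix, as
  \<open>gauss\<close>, given by its covariance\<close>

lemma qform_eq_qf: "qform K = qf (idx K)"
  by (simp add: fun_eq_iff qform_def qf_def)

lemma detK_eq_sdet: "detK K = sdet (idx K)"
  by (simp add: fun_eq_iff detK_def sdet_def)

lemma finite_idx [simp]: "finite (idx K)"
  by (simp add: idx_def)

text \<open>\<open>invK\<close> picks the unique left inverse that vanishes off the index set.
  Symmetry of \<open>M\<close> turns solutions of the unit systems into such a left inverse; the
  same solutions, forming a right inverse, force uniqueness.\<close>

lemma invK_right_inverse: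
  assumes M: "pos_def (idx K) M" and kl: "k \<in> idx K" "l \<in> idx K"
  shows "(\<Sum>m\<in>idx K. M k m * invK K M m l) = (if k = l then 1 else 0)"
proof -
  let ?S = "idx K"
  have "\<exists>U. \<forall>l. \<forall>k\<in>?S. (\<Sum>m\<in>?S. M k m * U l m) = (if k = l then 1 else 0)"
    by (intro choice allI pos_def_solvable[OF finite_idx M])
  then obtain U where U: "\<And>k l. k \<in> ?S \<Longrightarrow> (\<Sum>m\<in>?S. M k m * U l m) = (if k = l then 1 else 0)"
    by blast
  let ?P = "\<lambda>B. (\<forall>i\<in>?S. \<forall>j\<in>?S. (\<Sum>k\<in>?S. B i k * M k j) = (if i = j then 1 else 0)) \<and>
      (\<forall>i j. i \<notin> ?S \<or> j \<notin> ?S \<longrightarrow> B i j = 0)"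
  \<comment> \<open>\<open>U l\<close> is column \<open>l\<close> of the inverse; using the columns
    as rows gives a left inverse, by symmetry of \<open>M\<close>.\<close>
  define A where "A i j = (if i \<in> ?S \<and> j \<in> ?S then U i j else 0)" for i j
  have "(\<Sum>k\<in>?S. A i k * M k j) = (if i = j then 1 else 0)" if "i \<in> ?S" "j \<in> ?S" for i j
  proof -
    have "(\<Sum>k\<in>?S. A i k * M k j) = (\<Sum>k\<in>?S. M j k * U i k)"
      using that pos_def_sym[OF M] by (intro sum.cong) (auto simp: A_def)
    then show ?thesis using U[OF that(2), of i] by (simp add: eq_commute[of j i])
  qed
  then have PA: "?P A" by (simp add: A_def)
  have uniq: "B i j = (if i \<in> ?S \<and> j \<in> ?S then U j i else 0)" if "?P B" for B i j
  proof (cases "i \<in> ?S \<and> j \<in> ?S")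
    case True
    have "B i j = (\<Sum>k\<in>?S. B i k * (if k = j then 1 else 0))"
      using True by (simp add: if_distrib[of "\<lambda>x. _ * x"] cong: if_cong)
    also have "\<dots> = (\<Sum>k\<in>?S. B i k * (\<Sum>m\<in>?S. M k m * U j m))"
      using U[of _ j] by simp
    also have "\<dots> = (\<Sum>m\<in>?S. (\<Sum>k\<in>?S. B i k * M k m) * U j m)"
      unfolding sum_distrib_left sum_distrib_right by (subst sum.swap) (simp only: mult_ac)
    also have "\<dots> = (\<Sum>m\<in>?S. if i = m then U j m else 0)"
    proof (rule sum.cong)
      fix m assume "m \<in> ?S"
      then have "(\<Sum>k\<in>?S. B i k * M k m) = (if i = m then 1 else 0)" using that True by blast
      then show "(\<Sum>k\<in>?S. B i k * M k m) * U j m = (if i = m then U j m else 0)" by simp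
    qed simp
    also have "\<dots> = U j i" using True by simp
    finally show ?thesis using True by simp
  next
    case False
    with that have "B i j = 0" by blast
    then show ?thesis by (simp only: if_not_P[OF False])
  qed
  have invP: "?P (invK K M)"
    unfolding invK_def
  proof (rule theI[of ?P A])
    show "?P A" by (rule PA)
    show "B = A" if "?P B" for B
      by (intro ext) (simp only: uniq[OF that] uniq[OF PA])
  qed
  then have "invK K M m l = U l m" if "m \<in> ?S" for m
    using uniq[OF invP, of m l] that kl by simp
  then have "(\<Sum>m\<in>?S. M k m * invK K M m l) = (\<Sum>m\<in>?S. M k m * U l m)"
    by (intro sum.cong refl) simp
  then show ?thesis using U[OF kl(1), of l] by simp
qed

text \<open>Determinant and quadratic form depend only on the index set, so every enumeration
  \<open>L\<close> gives the same density; this is what later allows \<open>j\<close> to be put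
  first.\<close>

lemma QK_eq_gauss:
  assumes B: "pos_def (idx K) B" and L: "distinct L" "set L = idx K"
    and inv: "\<And>k l. k \<in> idx K \<Longrightarrow> l \<in> idx K \<Longrightarrow>
      (\<Sum>m\<in>idx K. B k m * A m l) = (if k = l then 1 else 0)"
  shows "QK K w A = gauss L w B"
proof -
  have len: "length L = K" using L distinct_card[of L] by (simp add: idx_def)
  have BL: "pos_def (set L) B" using B L(2) by simp
  have "gdet L B * sdet (idx K) A = 1"
    using gdet_sdet_inverse[OF BL L(1), of A] inv L(2) by simp
  then have d: "sdet (idx K) A = inverse (gdet L B)"
    by (rule inverse_unique[symmetric])
  have f: "gform L w B = qf (idx K) A w"
    using gform_eq_qf_inverse[OF BL L(1), of A w] inv L(2) by simp
  have c: "(2 * pi) powr (- real K / 2) = inverse (sqrt ((2 * pi) ^ K))"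
  proof -
    have "sqrt ((2 * pi) ^ K) = ((2 * pi) powr real K) powr (1 / 2)"
      by (simp add: powr_half_sqrt powr_realpow)
    also have "\<dots> = (2 * pi) powr (real K / 2)" by (simp only: powr_powr) simp
    finally show ?thesis by (simp add: powr_minus[symmetric])
  qed
  have "QK K w A = inverse (sqrt ((2 * pi) ^ K)) * sqrt (inverse (gdet L B)) * exp (- gform L w B / 2)"
    by (simp only: QK_def c detK_eq_sdet qform_eq_qf d f)
  also have "\<dots> = gauss L w B"
    unfolding gauss_eq[OF BL L(1)] len real_sqrt_mult real_sqrt_inverse
    by (simp only: divide_inverse inverse_mult_distrib mult_ac)
  finally show ?thesis .
qed

section \<open>Marginals and comparison of Gaussian densities\<close>

lemma borel_measurable_gauss:
  assumes "\<And>i. i \<in> set L \<Longrightarrow> (\<lambda>x. W x i) \<in> borel_measurable M"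
    and "\<And>i j. i \<in> set L \<Longrightarrow> j \<in> set L \<Longrightarrow> (\<lambda>x. B x i j) \<in> borel_measurable M"
  shows "(\<lambda>x. gauss L (W x) (B x)) \<in> borel_measurable M"
  using assms
proof (induction L arbitrary: W B)
  case (Cons i L)
  have [measurable]: "(\<lambda>x. W x i) \<in> borel_measurable M" "(\<lambda>x. B x i i) \<in> borel_measurable M"
    using Cons.prems by auto
  have m: "(\<lambda>x. W x k) \<in> borel_measurable M" "(\<lambda>x. B x k i) \<in> borel_measurable M"
    "(\<lambda>x. B x i k) \<in> borel_measurable M" if "k \<in> set L" for k
    using Cons.prems that by auto
  have "(\<lambda>x. gauss L (\<lambda>k. W x k - B x k i / B x i i * W x i) (schur i (B x))) \<in> borel_measurable M"
  proof (rule Cons.IH)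
    fix k assume "k \<in> set L"
    note [measurable] = m[OF this]
    show "(\<lambda>x. W x k - B x k i / B x i i * W x i) \<in> borel_measurable M" by measurable
  next
    fix k l assume k: "k \<in> set L" and l: "l \<in> set L"
    have [measurable]: "(\<lambda>x. B x k l) \<in> borel_measurable M" using Cons.prems k l by auto
    note [measurable] = m[OF k] m[OF l]
    show "(\<lambda>x. schur i (B x) k l) \<in> borel_measurable M" unfolding schur_def by measurable
  qed
  note [measurable] = this
  show ?case unfolding gauss.simps normal_density_def by measurable
qed simp

lemma gauss_nonneg: "0 \<le> gauss L w B"
  by (induction L arbitrary: w B) auto

lemma nn_integral_normal_density:
  assumes "0 < \<sigma>"
  shows "(\<integral>\<^sup>+x. ennreal (normal_density \<mu> \<sigma> x) \<partial>lborel) = 1"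
proof -
  interpret prob_space "density lborel (normal_density \<mu> \<sigma>)"
    by (rule prob_space_normal_density[OF assms])
  show ?thesis using emeasure_space_1 by (simp add: emeasure_density)
qed

text \<open>Every elimination step before the last only translates coordinate \<open>m\<close>, by
  an amount not involving it. By translation invariance the innermost one-dimensional density
  therefore integrates to 1.\<close>

lemma nn_integral_gauss_snoc:
  assumes "pos_def (set (L @ [m])) B" "distinct (L @ [m])"
  shows "(\<integral>\<^sup>+s. ennreal (gauss (L @ [m]) (w(m := s)) B) \<partial>lborel) = ennreal (gauss L w B)"
  using assms
proof (induction L arbitrary: w B)
  case Nil
  then have "B m m > 0" using pos_def_diag[of "{m}" B m] by simp
  then show ?case by (simp add: nn_integral_normal_density)
next
  case (Cons i L)
  note d = pos_def_ConsD[OF Cons.prems[unfolded append_Cons]]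
  have im: "i \<noteq> m" "m \<noteq> i" and dist: "distinct (L @ [m])" using Cons.prems(2) by auto
  define w' where "w' k = w k - B k i / B i i * w i" for k
  define a where "a = B m i / B i i * w i"
  let ?n = "normal_density 0 (sqrt (B i i)) (w i)"
  let ?g = "\<lambda>s. gauss (L @ [m]) (w'(m := s)) (schur i B)"
  have g: "?g \<in> borel_measurable borel"
    by (intro borel_measurable_gauss) auto
  have "gauss ((i # L) @ [m]) (w(m := s)) B = ?n * ?g (- a + 1 * s)" for s
  proof -
    have "(\<lambda>k. (w(m := s)) k - B k i / B i i * (w(m := s)) i) = w'(m := - a + 1 * s)"
      using im by (auto simp: w'_def a_def)
    then show ?thesis using im by simp
  qed
  then have "(\<integral>\<^sup>+s. ennreal (gauss ((i # L) @ [m]) (w(m := s)) B) \<partial>lborel)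
    = (\<integral>\<^sup>+s. ennreal ?n * ennreal (?g (- a + 1 * s)) \<partial>lborel)"
    by (simp add: ennreal_mult gauss_nonneg)
  also have "\<dots> = ennreal ?n * (\<integral>\<^sup>+s. ennreal (?g (- a + 1 * s)) \<partial>lborel)"
    using g by (intro nn_integral_cmult) simp
  also have "(\<integral>\<^sup>+s. ennreal (?g (- a + 1 * s)) \<partial>lborel) = (\<integral>\<^sup>+s. ennreal (?g s) \<partial>lborel)"
    using nn_integral_real_affine[of "\<lambda>s. ennreal (?g s)" 1 "- a"] g by simp
  also have "\<dots> = ennreal (gauss L w' (schur i B))"
    using d(2) dist by (rule Cons.IH)
  also have "ennreal ?n * \<dots> = ennreal (gauss (i # L) w B)"
    by (simp add: ennreal_mult gauss_nonneg w'_def[abs_def])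
  finally show ?case .
qed

lemma pos_def_scale:
  assumes "pos_def S B" "c > 0"
  shows "pos_def S (\<lambda>k l. c * B k l)"
proof (rule pos_defI)
  fix k l assume "k \<in> S" "l \<in> S"
  then show "c * B k l = c * B l k" using pos_def_sym[OF assms(1), of k l] by simp
next
  fix v :: "'a \<Rightarrow> real" and i assume "i \<in> S" "v i \<noteq> 0"
  then show "0 < qf S (\<lambda>k l. c * B k l) v"
    using pos_def_pos[OF assms(1)] assms(2) by (simp add: qf_scale)
qed

text \<open>Inflating \<open>B0\<close> by \<open>1 + e\<close> makes the exponential dominate, by
  \<open>gform_antimono\<close>. In the normalisation, the inflation and the comparison of
  determinants each contribute \<open>(1 + e) ^ length L\<close> under the square root.\<close>

lemma gauss_perturb:
  assumes B: "pos_def (set L) B" and B0: "pos_def (set L) B0" and L: "distinct L" and e: "0 \<le> e"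
    and le: "\<And>v. qf (set L) B v \<le> (1 + e) * qf (set L) B0 v"
    and ge: "\<And>v. qf (set L) B0 v \<le> (1 + e) * qf (set L) B v"
  shows "gauss L w B \<le> (1 + e) ^ length L * gauss L w (\<lambda>k l. (1 + e) * B0 k l)"
proof -
  have e1: "1 + e > 0" using e by simp
  let ?n = "length L" and ?D = "\<lambda>k l. (1 + e) * B0 k l" and ?B = "\<lambda>k l. (1 + e) * B k l"
  note pd = pos_def_scale[OF B0 e1] pos_def_scale[OF B e1]
  have "gform L w ?D \<le> gform L w B"
    by (rule gform_antimono[OF B pd(1) L]) (simp add: qf_scale le)
  then have expo: "exp (- gform L w B / 2) \<le> exp (- gform L w ?D / 2)" by simp
  have "gdet L B0 \<le> gdet L ?B"
    by (rule gdet_mono[OF B0 pd(2) L]) (simp add: qf_scale ge)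
  then have "(1 + e) ^ ?n * gdet L B0 \<le> (1 + e) ^ ?n * ((1 + e) ^ ?n * gdet L B)"
    using e1 by (simp add: gdet_scale)
  then have det: "gdet L ?D \<le> ((1 + e) ^ ?n)\<^sup>2 * gdet L B"
    using e1 by (simp add: gdet_scale power2_eq_square mult.assoc)
  have pos: "gdet L B > 0" "gdet L ?D > 0" "(1 + e) ^ ?n > 0" "(2 * pi) ^ ?n > 0"
    using gdet_pos[OF B L] gdet_pos[OF pd(1) L] e1 by auto
  have "sqrt ((2 * pi) ^ ?n * gdet L ?D) \<le> sqrt (((1 + e) ^ ?n)\<^sup>2 * ((2 * pi) ^ ?n * gdet L B))"
    using det pos(4) by (simp add: mult_ac)
  also have "\<dots> = (1 + e) ^ ?n * sqrt ((2 * pi) ^ ?n * gdet L B)"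
    using pos(3) by (simp add: real_sqrt_mult)
  finally have sq: "sqrt ((2 * pi) ^ ?n * gdet L ?D) \<le> (1 + e) ^ ?n * sqrt ((2 * pi) ^ ?n * gdet L B)" .
  have spos: "sqrt ((2 * pi) ^ ?n * gdet L ?D) > 0" "sqrt ((2 * pi) ^ ?n * gdet L B) > 0"
    using pos by auto
  have gen: "x / s \<le> t * (y / r)" if "x \<le> y" "r \<le> t * s" "0 < r" "0 < s" "0 < x" for x y s r t :: real
  proof -
    have "0 < t * s" using that by linarith
    then have "0 < t" using that(4) by (simp add: zero_less_mult_iff)
    have "x * r \<le> y * (t * s)" using that by (intro mult_mono) auto
    then show ?thesis using that by (simp add: field_simps)
  qed
  show ?thesis
    unfolding gauss_eq[OF B L] gauss_eq[OF pd(1) L]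
    by (rule gen[OF expo sq spos]) simp
qed

lemma qf_schur_ge:
  assumes B: "pos_def (insert i T) B" and T: "finite T" "i \<notin> T" and c: "0 \<le> c"
    and le: "\<And>v. c * (\<Sum>k\<in>insert i T. (v k)\<^sup>2) \<le> qf (insert i T) B v"
  shows "c * (\<Sum>k\<in>T. (v k)\<^sup>2) \<le> qf T (schur i B) v"
proof -
  let ?v = "v(i := - (\<Sum>k\<in>T. B i k * v k) / B i i)"
  have "(\<Sum>k\<in>T. (v k)\<^sup>2) = (\<Sum>k\<in>T. (?v k)\<^sup>2)"
    using T by (intro sum.cong) auto
  also have "\<dots> \<le> (\<Sum>k\<in>insert i T. (?v k)\<^sup>2)"
    using T by (intro sum_mono2) auto
  finally have "c * (\<Sum>k\<in>T. (v k)\<^sup>2) \<le> c * (\<Sum>k\<in>insert i T. (?v k)\<^sup>2)"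
    using c by (rule mult_left_mono)
  also have "\<dots> \<le> qf (insert i T) B ?v" by (rule le)
  finally show ?thesis unfolding qf_schur_attained[OF B T] .
qed

text \<open>Schur complements keep the lower bound, so every pivot is at least
  \<open>c\<close>.\<close>

lemma gdet_ge:
  assumes "pos_def (set L) B" "distinct L" "0 \<le> c"
    and "\<And>v. c * (\<Sum>k\<in>set L. (v k)\<^sup>2) \<le> qf (set L) B v"
  shows "c ^ length L \<le> gdet L B"
  using assms
proof (induction L arbitrary: B)
  case (Cons i L)
  note d = pos_def_ConsD[OF Cons.prems(1,2)]
  have i: "i \<notin> set L" "distinct L" using Cons.prems(2) by auto
  note p = Cons.prems(1,4)[unfolded list.set(2)]
  have "(\<Sum>k\<in>insert i (set L). (if k = i then 1 else 0 :: real)\<^sup>2) = 1"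
    using i(1) by (simp add: if_distrib[of "\<lambda>x. x\<^sup>2"] cong: if_cong)
  with p(2)[of "\<lambda>k. if k = i then 1 else 0"] have "c \<le> B i i"
    by (simp add: qf_unit)
  moreover have "c ^ length L \<le> gdet L (schur i B)"
    by (rule Cons.IH[OF d(2) i(2) Cons.prems(3)])
      (rule qf_schur_ge[OF p(1) finite_set i(1) Cons.prems(3) p(2)])
  ultimately show ?case
    using Cons.prems(3) d(1) unfolding gdet.simps list.size
    by (simp add: mult_mono)
qed simp

lemma gauss_le:
  assumes B: "pos_def (set L) B" and L: "distinct L" and c: "0 < c" "0 < C"
    and ge: "\<And>v. c * (\<Sum>k\<in>set L. (v k)\<^sup>2) \<le> qf (set L) B v"
    and le: "\<And>v. qf (set L) B v \<le> C * (\<Sum>k\<in>set L. (v k)\<^sup>2)"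
  shows "gauss L w B \<le> (1 / sqrt (2 * pi * c)) ^ length L * exp (- (\<Sum>k\<in>set L. (w k)\<^sup>2) / (2 * C))"
proof -
  let ?s = "\<Sum>k\<in>set L. (w k)\<^sup>2" and ?n = "length L"
  \<comment> \<open>Bounds the maximum \<open>gform\<close> from below by the test vector
    \<open>w / C\<close>, which is optimal for \<open>C\<close> times the identity.\<close>
  have "?s / C = 2 * (?s / C) - C * (\<Sum>k\<in>set L. (w k / C)\<^sup>2)"
    using c by (simp add: power_divide sum_divide_distrib[symmetric] power2_eq_square)
  also have "\<dots> \<le> 2 * (?s / C) - qf (set L) B (\<lambda>k. w k / C)"
    using le[of "\<lambda>k. w k / C"] by simp
  also have "?s / C = (\<Sum>k\<in>set L. w k / C * w k)"
    by (simp add: sum_divide_distrib power2_eq_square)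
  also have "2 * (\<Sum>k\<in>set L. w k / C * w k) - qf (set L) B (\<lambda>k. w k / C) \<le> gform L w B"
    by (rule gform_ge[OF B L])
  finally have "(\<Sum>k\<in>set L. w k / C * w k) \<le> gform L w B" .
  also have "(\<Sum>k\<in>set L. w k / C * w k) = ?s / C"
    by (simp add: sum_divide_distrib power2_eq_square)
  finally have e: "exp (- gform L w B / 2) \<le> exp (- ?s / (2 * C))"
    by simp
  have "c ^ ?n \<le> gdet L B" using c(1) by (intro gdet_ge[OF B L _ ge]) simp
  then have "(2 * pi) ^ ?n * c ^ ?n \<le> (2 * pi) ^ ?n * gdet L B"
    by (intro mult_left_mono) auto
  then have "sqrt (2 * pi * c) ^ ?n \<le> sqrt ((2 * pi) ^ ?n * gdet L B)"
    by (simp add: real_sqrt_power[symmetric] power_mult_distrib)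
  moreover have "0 < sqrt (2 * pi * c) ^ ?n" using c by simp
  ultimately have "exp (- gform L w B / 2) / sqrt ((2 * pi) ^ ?n * gdet L B)
    \<le> exp (- ?s / (2 * C)) / sqrt (2 * pi * c) ^ ?n"
    using e by (intro frac_le) auto
  then show ?thesis by (simp add: gauss_eq[OF B L] power_divide)
qed

lemma normal_density_rescale:
  assumes "0 < c"
  shows "normal_density 0 \<sigma> x = c * normal_density 0 (c * \<sigma>) (c * x)"
proof -
  have "sqrt (2 * pi * (c * \<sigma>)\<^sup>2) = c * sqrt (2 * pi * \<sigma>\<^sup>2)"
    using assms by (simp add: power_mult_distrib real_sqrt_mult)
  moreover have "(c * x)\<^sup>2 / (2 * (c * \<sigma>)\<^sup>2) = x\<^sup>2 / (2 * \<sigma>\<^sup>2)"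
    using assms by (simp add: power_mult_distrib)
  ultimately show ?thesis
    using assms unfolding normal_density_def by (simp only: minus_divide_left[symmetric] diff_0_right) simp
qed

text \<open>Diagonal rescaling commutes with each elimination step; the extracted factor is the
  Jacobian of the substitution.\<close>

lemma gauss_rescale:
  assumes "\<And>i. 0 < c i"
  shows "gauss L w B = prod_list (map c L) * gauss L (\<lambda>k. c k * w k) (\<lambda>k l. c k * c l * B k l)"
proof (induction L arbitrary: w B)
  case (Cons i L)
  have c: "c k \<noteq> 0" for k using assms[of k] by simp
  have "schur i (\<lambda>k l. c k * c l * B k l) = (\<lambda>k l. c k * c l * schur i B k l)"
    using c by (simp add: schur_def fun_eq_iff right_diff_distrib)
  moreover have "(\<lambda>k. c k * w k - c k * c i * B k i / (c i * c i * B i i) * (c i * w i))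
    = (\<lambda>k. c k * (w k - B k i / B i i * w i))"
    using c by (simp add: fun_eq_iff right_diff_distrib)
  moreover have "normal_density 0 (sqrt (B i i)) (w i)
    = c i * normal_density 0 (sqrt (c i * c i * B i i)) (c i * w i)"
  proof -
    have "sqrt (c i * c i * B i i) = c i * sqrt (B i i)"
      using assms[of i] by (simp add: real_sqrt_mult)
    then show ?thesis using normal_density_rescale[OF assms] by metis
  qed
  ultimately show ?case
    using Cons.IH[of "\<lambda>k. w k - B k i / B i i * w i" "schur i B"] by simp
qed simp

section \<open>Covariance depending on the integration variable\<close>

lemma powr_le_exp:
  fixes x p r :: real
  assumes "0 \<le> x" "0 \<le> p" "0 < r"
  shows "x powr p \<le> ((p + 1) / r) powr p * exp (r * x)"
proof (cases "x = 0")
  case False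
  \<comment> \<open>With \<open>p + 1\<close> in place of \<open>p\<close> the constant stays
    positive at \<open>p = 0\<close>.\<close>
  define a where "a = (p + 1) / r"
  have a: "a > 0" using assms by (simp add: a_def)
  have x: "x > 0" using assms False by simp
  have "x / a \<le> exp (x / a)" using exp_ge_add_one_self[of "x / a"] by linarith
  then have "x \<le> a * exp (x / a)" using a by (simp add: field_simps)
  then have "x powr p \<le> (a * exp (x / a)) powr p" using assms by (intro powr_mono2) auto
  also have "\<dots> = a powr p * exp (p * (x / a))"
    using a by (simp add: powr_mult powr_def[of "exp _"])
  also have "\<dots> \<le> a powr p * exp (r * x)"
  proof -
    have "p * (x / a) = r * x * (p / (p + 1))" using assms by (simp add: a_def)
    also have "\<dots> \<le> r * x * 1" using assms by (intro mult_left_mono) auto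
    finally show ?thesis by (intro mult_left_mono) auto
  qed
  finally show ?thesis by (simp add: a_def)
qed simp

lemma nn_integral_exp_square:
  assumes "0 < r"
  shows "(\<integral>\<^sup>+x. ennreal (exp (- r * x\<^sup>2)) \<partial>lborel) = ennreal (sqrt (pi / r))"
proof -
  have "exp (- r * x\<^sup>2) = sqrt (pi / r) * normal_density 0 (sqrt (1 / (2 * r))) x" for x
  proof -
    have "normal_density 0 (sqrt (1 / (2 * r))) x
      = exp (- (x\<^sup>2 / (1 / (2 * r))) / 2) / sqrt (2 * pi * (1 / (2 * r)))"
      using assms by (intro normal_density_sqrt) simp
    also have "2 * pi * (1 / (2 * r)) = pi / r" by simp
    also have "- (x\<^sup>2 / (1 / (2 * r))) / 2 = - r * x\<^sup>2" by simp
    finally show ?thesis using assms by simp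
  qed
  then have "(\<integral>\<^sup>+x. ennreal (exp (- r * x\<^sup>2)) \<partial>lborel)
    = (\<integral>\<^sup>+x. ennreal (sqrt (pi / r)) * ennreal (normal_density 0 (sqrt (1 / (2 * r))) x) \<partial>lborel)"
    using assms by (simp add: ennreal_mult)
  also have "\<dots> = ennreal (sqrt (pi / r))"
    using assms by (subst nn_integral_cmult) (simp_all add: nn_integral_normal_density)
  finally show ?thesis .
qed

lemma nn_integral_PiM_exp_square:
  assumes "finite S" "0 < r" "0 \<le> a"
  shows "(\<integral>\<^sup>+w. ennreal (a * (\<Prod>i\<in>S. exp (- r * (w i)\<^sup>2))) \<partial>(PiM S (\<lambda>_. lborel)))
    = ennreal (a * sqrt (pi / r) ^ card S)"
proof -
  interpret product_sigma_finite "\<lambda>_. lborel :: real measure"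
    by (rule product_sigma_finite.intro) (rule sigma_finite_lborel)
  have "(\<integral>\<^sup>+w. ennreal (a * (\<Prod>i\<in>S. exp (- r * (w i)\<^sup>2))) \<partial>(PiM S (\<lambda>_. lborel)))
    = (\<integral>\<^sup>+w. ennreal a * (\<Prod>i\<in>S. ennreal (exp (- r * (w i)\<^sup>2))) \<partial>(PiM S (\<lambda>_. lborel)))"
    using assms(3) by (simp add: ennreal_mult prod_ennreal prod_nonneg)
  also have "\<dots> = ennreal a * (\<integral>\<^sup>+w. (\<Prod>i\<in>S. ennreal (exp (- r * (w i)\<^sup>2))) \<partial>(PiM S (\<lambda>_. lborel)))"
    by (intro nn_integral_cmult) measurable
  also have "(\<integral>\<^sup>+w. (\<Prod>i\<in>S. ennreal (exp (- r * (w i)\<^sup>2))) \<partial>(PiM S (\<lambda>_. lborel)))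
    = (\<Prod>i\<in>S. (\<integral>\<^sup>+x. ennreal (exp (- r * x\<^sup>2)) \<partial>lborel))"
    by (rule product_nn_integral_prod[OF assms(1), of "\<lambda>_ x. ennreal (exp (- r * x\<^sup>2))"]) measurable
  also have "\<dots> = ennreal (sqrt (pi / r)) ^ card S"
    by (simp only: nn_integral_exp_square[OF assms(2)] prod_constant)
  finally show ?thesis
    using assms(2,3) by (simp add: ennreal_mult ennreal_power)
qed

lemma pos_defI_bound:
  assumes "finite S" "0 < c" "\<And>i j. i \<in> S \<Longrightarrow> j \<in> S \<Longrightarrow> B i j = B j i"
    and "\<And>v. c * (\<Sum>k\<in>S. (v k)\<^sup>2) \<le> qf S B v"
  shows "pos_def S B"
proof (rule pos_defI[OF assms(3)])
  fix v :: "'a \<Rightarrow> real" and i assume "i \<in> S" "v i \<noteq> 0"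
  then have "0 < (\<Sum>k\<in>S. (v k)\<^sup>2)" using assms(1) by (intro sum_pos2[of S i]) auto
  with assms(2) have "0 < c * (\<Sum>k\<in>S. (v k)\<^sup>2)" by simp
  also have "\<dots> \<le> qf S B v" by (rule assms(4))
  finally show "0 < qf S B v" .
qed auto

text \<open>The available decay rate 1/(2C) is split as 1/(8C) + 1/(8C) + 1/(4C): the first share
  absorbs the moment factor, the second remains as an integrable product, the third is reserved for
  the tail.\<close>

lemma moment_gauss_le:
  assumes B: "pos_def (set L) B" and L: "distinct L" and j: "j \<in> set L" and c: "0 < c" "0 < C" and p: "0 \<le> p"
    and ge: "\<And>v. c * (\<Sum>k\<in>set L. (v k)\<^sup>2) \<le> qf (set L) B v"
    and le: "\<And>v. qf (set L) B v \<le> C * (\<Sum>k\<in>set L. (v k)\<^sup>2)"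
  shows "\<bar>w j\<bar> powr (2 * p) * gauss L w B
    \<le> (8 * C * (p + 1)) powr p * (1 / sqrt (2 * pi * c)) ^ length L
      * exp (- (\<Sum>k\<in>set L. (w k)\<^sup>2) / (4 * C)) * (\<Prod>i\<in>set L. exp (- (1 / (8 * C)) * (w i)\<^sup>2))"
proof -
  let ?s = "\<Sum>k\<in>set L. (w k)\<^sup>2" and ?M = "(8 * C * (p + 1)) powr p"
  have "\<bar>w j\<bar> powr (2 * p) = (\<bar>w j\<bar> powr 2) powr p" by (simp only: powr_powr)
  also have "\<bar>w j\<bar> powr 2 = (w j)\<^sup>2" by (simp add: powr_numeral)
  also have "((w j)\<^sup>2) powr p \<le> ((p + 1) / (1 / (8 * C))) powr p * exp (1 / (8 * C) * (w j)\<^sup>2)"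
    using c p by (intro powr_le_exp) auto
  also have "((p + 1) / (1 / (8 * C))) = 8 * C * (p + 1)" by simp
  also have "?M * exp (1 / (8 * C) * (w j)\<^sup>2) \<le> ?M * exp (1 / (8 * C) * ?s)"
    using c j by (intro mult_left_mono) (auto intro!: divide_right_mono member_le_sum)
  finally have m: "\<bar>w j\<bar> powr (2 * p) \<le> ?M * exp (1 / (8 * C) * ?s)" .
  have "\<bar>w j\<bar> powr (2 * p) * gauss L w B
    \<le> (?M * exp (1 / (8 * C) * ?s)) * ((1 / sqrt (2 * pi * c)) ^ length L * exp (- ?s / (2 * C)))"
    by (rule mult_mono[OF m gauss_le[OF B L c ge le]]) (auto intro: gauss_nonneg)
  also have "\<dots> = ?M * (1 / sqrt (2 * pi * c)) ^ length L * (exp (1 / (8 * C) * ?s) * exp (- ?s / (2 * C)))"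
    by (simp only: mult_ac)
  also have "exp (1 / (8 * C) * ?s) * exp (- ?s / (2 * C))
    = exp (- ?s / (4 * C)) * exp (- (1 / (8 * C)) * ?s)"
  proof -
    have "1 / (8 * C) * ?s + - ?s / (2 * C) = - ?s / (4 * C) + - (1 / (8 * C)) * ?s"
      using c by (simp add: field_simps)
    then show ?thesis by (simp only: exp_add[symmetric])
  qed
  also have "exp (- (1 / (8 * C)) * ?s) = (\<Prod>i\<in>set L. exp (- (1 / (8 * C)) * (w i)\<^sup>2))"
    by (simp only: sum_distrib_left exp_sum[OF finite_set])
  finally show ?thesis by (simp only: mult.assoc)
qed

text \<open>In a product space over fewer coordinates the deleted ones read as
  \<open>undefined\<close>. Zero gives the covariance a definite argument, and it is the value at
  which a coordinate is frozen when it is removed.\<close>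

definition zero_outside :: "'a set \<Rightarrow> ('a \<Rightarrow> real) \<Rightarrow> 'a \<Rightarrow> real" where
  "zero_outside T w = (\<lambda>k. if k \<in> T then w k else 0)"

lemma measurable_zero_outside:
  assumes "T \<subseteq> S"
  shows "zero_outside T \<in> measurable (PiM S (\<lambda>_. lborel)) (PiM UNIV (\<lambda>_. borel))"
  unfolding zero_outside_def[abs_def]
proof (rule measurable_PiM_single')
  show "(\<lambda>w. if i \<in> T then w i else 0 :: real) \<in> measurable (PiM S (\<lambda>_. lborel)) borel" for i
    using measurable_component_singleton[of i S "\<lambda>_. lborel :: real measure"] assms
    by (cases "i \<in> T") auto
qed auto

text \<open>State of the iteration when the coordinates of \<open>L\<close> remain: the others are
  frozen at 0 inside the covariance, and \<open>s\<close> is the accumulated inflation.\<close>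

definition moment_int :: "'a \<Rightarrow> real \<Rightarrow> (('a \<Rightarrow> real) \<Rightarrow> 'a \<Rightarrow> 'a \<Rightarrow> real) \<Rightarrow> 'a list \<Rightarrow> real \<Rightarrow> ennreal" where
  "moment_int j p B L s = (\<integral>\<^sup>+w. ennreal (\<bar>w j\<bar> powr (2 * p)
     * gauss L w (\<lambda>k l. s * B (zero_outside (set L) w) k l)) \<partial>(PiM (set L) (\<lambda>_. lborel)))"

lemma borel_measurable_moment_integrand:
  assumes B: "\<And>k l. k \<in> S \<Longrightarrow> l \<in> S \<Longrightarrow> (\<lambda>w. B w k l) \<in> borel_measurable (PiM UNIV (\<lambda>_. borel))"
    and j: "j \<in> S" and L: "set L \<subseteq> S" "T \<subseteq> S"
  shows "(\<lambda>w. \<bar>w j\<bar> powr (2 * p) * gauss L w (\<lambda>k l. s * B (zero_outside T w) k l))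
    \<in> borel_measurable (PiM S (\<lambda>_. lborel))"
proof -
  have w: "(\<lambda>w. w k) \<in> borel_measurable (PiM S (\<lambda>_. lborel :: real measure))" if "k \<in> S" for k
    using measurable_component_singleton[OF that, of "\<lambda>_. lborel :: real measure"] by simp
  have "(\<lambda>w. s * B (zero_outside T w) k l) \<in> borel_measurable (PiM S (\<lambda>_. lborel))"
    if "k \<in> S" "l \<in> S" for k l
    using measurable_compose[OF measurable_zero_outside[OF L(2)] B[OF that]]
    by (rule borel_measurable_times[OF borel_measurable_const])
  then have [measurable]: "(\<lambda>w. gauss L w (\<lambda>k l. s * B (zero_outside T w) k l))
      \<in> borel_measurable (PiM S (\<lambda>_. lborel))"
    using L(1) by (intro borel_measurable_gauss) (auto intro: w)
  note [measurable] = w[OF j]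
  show ?thesis by measurable
qed

lemma gauss_normalization:
  assumes "0 < c" "0 < C"
  shows "1 / sqrt (2 * pi * c) * sqrt (pi / (1 / (8 * C))) = 2 * sqrt (C / c)"
proof -
  have "1 / sqrt (2 * pi * c) * sqrt (pi / (1 / (8 * C))) = sqrt (1 / (2 * pi * c) * (pi / (1 / (8 * C))))"
    by (simp only: real_sqrt_mult real_sqrt_divide real_sqrt_one)
  also have "1 / (2 * pi * c) * (pi / (1 / (8 * C))) = 2\<^sup>2 * (C / c)"
    using assms by (simp add: field_simps)
  also have "sqrt (2\<^sup>2 * (C / c)) = 2 * sqrt (C / c)"
    by (simp only: real_sqrt_mult real_sqrt_abs abs_numeral)
  finally show ?thesis .
qed

text \<open>Scaling by \<open>s\<close> preserves the two comparisons in \<open>near\<close>. The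
  lower bound \<open>c\<close> survives because \<open>s\<close> is at least 1, and
  \<open>C'\<close> is meant as one upper bound for all inflations, so that the tail constants do
  not degrade along the iteration.\<close>

lemma moment_int_step:
  fixes B :: "('a \<Rightarrow> real) \<Rightarrow> 'a \<Rightarrow> 'a \<Rightarrow> real"
  assumes meas: "\<And>k l. k \<in> set (L @ [m]) \<Longrightarrow> l \<in> set (L @ [m]) \<Longrightarrow> (\<lambda>w. B w k l) \<in> borel_measurable (PiM UNIV (\<lambda>_. borel))"
    and L: "distinct (L @ [m])" and j: "j \<in> set L" and p: "0 \<le> p"
    and sym: "\<And>w k l. k \<in> set (L @ [m]) \<Longrightarrow> l \<in> set (L @ [m]) \<Longrightarrow> B w k l = B w l k"
    and c: "0 < c"
    and ge: "\<And>w v. c * (\<Sum>k\<in>set (L @ [m]). (v k)\<^sup>2) \<le> qf (set (L @ [m])) (B w) v"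
    and le: "\<And>w v. qf (set (L @ [m])) (B w) v \<le> C * (\<Sum>k\<in>set (L @ [m]). (v k)\<^sup>2)"
    and e: "0 \<le> e" and R: "0 \<le> R"
    and near: "\<And>w v. \<bar>w m\<bar> \<le> R \<Longrightarrow>
        qf (set (L @ [m])) (B w) v \<le> (1 + e) * qf (set (L @ [m])) (B (w(m := 0))) v"
      "\<And>w v. \<bar>w m\<bar> \<le> R \<Longrightarrow>
        qf (set (L @ [m])) (B (w(m := 0))) v \<le> (1 + e) * qf (set (L @ [m])) (B w) v"
    and s: "1 \<le> s" "s * C \<le> C'" "0 < C'"
  shows "moment_int j p B (L @ [m]) s
    \<le> ennreal ((1 + e) ^ length (L @ [m])) * moment_int j p B L ((1 + e) * s)
      + ennreal ((8 * C' * (p + 1)) powr p * (2 * sqrt (C' / c)) ^ length (L @ [m]) * exp (- R\<^sup>2 / (4 * C')))"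
proof -
  interpret product_sigma_finite "\<lambda>_. lborel :: real measure"
    by (rule product_sigma_finite.intro) (rule sigma_finite_lborel)
  let ?S = "set (L @ [m])" and ?n = "length (L @ [m])" and ?r = "1 / (8 * C')"
  have m: "m \<notin> set L" "m \<noteq> j" "j \<noteq> m" and S: "?S = insert m (set L)" and jS: "j \<in> ?S" using L j by auto
  have s0: "s > 0" using s by simp
  define M where "M = (8 * C' * (p + 1)) powr p * (1 / sqrt (2 * pi * c)) ^ ?n"
  have M: "0 \<le> M" using c by (simp add: M_def)
  define f where "f w = \<bar>w j\<bar> powr (2 * p) * gauss (L @ [m]) w (\<lambda>k l. s * B (zero_outside ?S w) k l)" for w
  define g where "g w = \<bar>w j\<bar> powr (2 * p)
      * gauss (L @ [m]) w (\<lambda>k l. (1 + e) * s * B (zero_outside (set L) w) k l)" for w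
  define h where "h w = M * exp (- R\<^sup>2 / (4 * C')) * (\<Prod>i\<in>?S. exp (- ?r * (w i)\<^sup>2))" for w :: "'a \<Rightarrow> real"
  have pd: "pos_def ?S (B w)" for w
    using c sym ge by (intro pos_defI_bound[of ?S c]) auto
  \<comment> \<open>Freezing \<open>m\<close> leads exactly to the argument used in the next state,
    and that argument no longer sees coordinate \<open>m\<close>.\<close>
  have zo: "(zero_outside ?S w)(m := 0) = zero_outside (set L) w" for w :: "'a \<Rightarrow> real"
    using m by (auto simp: zero_outside_def)
  have zo': "zero_outside (set L) (w(m := t)) = zero_outside (set L) w" for w :: "'a \<Rightarrow> real" and t
    using m by (auto simp: zero_outside_def fun_eq_iff)
  \<comment> \<open>Both terms on the right are nonnegative, so the near and far cases merge into
    one pointwise bound without indicator functions.\<close>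
  have bound: "f w \<le> (1 + e) ^ ?n * g w + h w" for w
  proof (cases "\<bar>w m\<bar> \<le> R")
    case True
    let ?B = "B (zero_outside ?S w)" and ?D = "B (zero_outside (set L) w)"
    have R': "\<bar>zero_outside ?S w m\<bar> \<le> R" using True by (simp add: zero_outside_def)
    have "gauss (L @ [m]) w (\<lambda>k l. s * ?B k l)
      \<le> (1 + e) ^ ?n * gauss (L @ [m]) w (\<lambda>k l. (1 + e) * (s * ?D k l))"
    proof (rule gauss_perturb[OF pos_def_scale[OF pd s0] pos_def_scale[OF pd s0] L e])
      show "qf ?S (\<lambda>k l. s * ?B k l) v \<le> (1 + e) * qf ?S (\<lambda>k l. s * ?D k l) v" for v
        using near(1)[of "zero_outside ?S w" v, OF R', unfolded zo] s0 by (simp add: qf_scale)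
      show "qf ?S (\<lambda>k l. s * ?D k l) v \<le> (1 + e) * qf ?S (\<lambda>k l. s * ?B k l) v" for v
        using near(2)[of "zero_outside ?S w" v, OF R', unfolded zo] s0 by (simp add: qf_scale)
    qed
    then have "f w \<le> \<bar>w j\<bar> powr (2 * p)
        * ((1 + e) ^ ?n * gauss (L @ [m]) w (\<lambda>k l. (1 + e) * (s * ?D k l)))"
      unfolding f_def by (rule mult_left_mono) simp
    also have "\<dots> = (1 + e) ^ ?n * g w" by (simp add: g_def mult_ac)
    also have "\<dots> \<le> (1 + e) ^ ?n * g w + h w"
      using M by (simp add: h_def prod_nonneg)
    finally show ?thesis .
  next
    case False
    let ?A = "\<lambda>k l. s * B (zero_outside ?S w) k l"
    have "f w \<le> M * exp (- (\<Sum>k\<in>?S. (w k)\<^sup>2) / (4 * C')) * (\<Prod>i\<in>?S. exp (- ?r * (w i)\<^sup>2))"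
      unfolding f_def M_def
    proof (rule moment_gauss_le[OF pos_def_scale[OF pd s0] L jS c s(3) p])
      fix v :: "'a \<Rightarrow> real"
      have nn: "0 \<le> (\<Sum>k\<in>?S. (v k)\<^sup>2)" by (intro sum_nonneg) auto
      have q0: "0 \<le> qf ?S (B (zero_outside ?S w)) v" using pos_def_nonneg[OF pd] .
      have "c * (\<Sum>k\<in>?S. (v k)\<^sup>2) \<le> 1 * qf ?S (B (zero_outside ?S w)) v" using ge by simp
      also have "\<dots> \<le> s * qf ?S (B (zero_outside ?S w)) v" using s(1) q0 by (rule mult_right_mono)
      finally show "c * (\<Sum>k\<in>?S. (v k)\<^sup>2) \<le> qf ?S ?A v" by (simp only: qf_scale)
      have "s * qf ?S (B (zero_outside ?S w)) v \<le> s * (C * (\<Sum>k\<in>?S. (v k)\<^sup>2))"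
        using s0 le by (intro mult_left_mono) auto
      also have "\<dots> \<le> C' * (\<Sum>k\<in>?S. (v k)\<^sup>2)"
        using mult_right_mono[OF s(2) nn] by (simp only: mult.assoc)
      finally show "qf ?S ?A v \<le> C' * (\<Sum>k\<in>?S. (v k)\<^sup>2)" by (simp only: qf_scale)
    qed
    also have "\<dots> \<le> h w"
    proof -
      have "R\<^sup>2 \<le> (w m)\<^sup>2" using False R by (simp add: abs_le_square_iff[symmetric])
      also have "\<dots> \<le> (\<Sum>k\<in>?S. (w k)\<^sup>2)" by (intro member_le_sum) auto
      finally have "exp (- (\<Sum>k\<in>?S. (w k)\<^sup>2) / (4 * C')) \<le> exp (- R\<^sup>2 / (4 * C'))"
        using s(3) by (simp add: divide_right_mono)
      then show ?thesis unfolding h_def using M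
        by (intro mult_right_mono mult_left_mono) (auto intro: prod_nonneg)
    qed
    also have "\<dots> \<le> (1 + e) ^ ?n * g w + h w"
      using e by (simp add: g_def gauss_nonneg)
    finally show ?thesis .
  qed
  have g0: "0 \<le> g w" for w by (simp add: g_def gauss_nonneg)
  have h0: "0 \<le> h w" for w using M by (simp add: h_def prod_nonneg)
  have gm: "g \<in> borel_measurable (PiM ?S (\<lambda>_. lborel))"
    unfolding g_def[abs_def] by (rule borel_measurable_moment_integrand[OF meas jS]) auto
  have hm: "h \<in> borel_measurable (PiM ?S (\<lambda>_. lborel))"
    unfolding h_def[abs_def] by measurable
  have "moment_int j p B (L @ [m]) s = (\<integral>\<^sup>+w. ennreal (f w) \<partial>(PiM ?S (\<lambda>_. lborel)))"
    unfolding moment_int_def f_def ..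
  also have "\<dots> \<le> (\<integral>\<^sup>+w. ennreal ((1 + e) ^ ?n) * ennreal (g w) + ennreal (h w) \<partial>(PiM ?S (\<lambda>_. lborel)))"
  proof (rule nn_integral_mono)
    fix w
    have "ennreal (f w) \<le> ennreal ((1 + e) ^ ?n * g w + h w)" by (rule ennreal_leI[OF bound])
    also have "\<dots> = ennreal ((1 + e) ^ ?n) * ennreal (g w) + ennreal (h w)"
      using e g0 h0 by (simp add: ennreal_mult)
    finally show "ennreal (f w) \<le> ennreal ((1 + e) ^ ?n) * ennreal (g w) + ennreal (h w)" .
  qed
  also have "\<dots> = ennreal ((1 + e) ^ ?n) * (\<integral>\<^sup>+w. ennreal (g w) \<partial>(PiM ?S (\<lambda>_. lborel)))
      + (\<integral>\<^sup>+w. ennreal (h w) \<partial>(PiM ?S (\<lambda>_. lborel)))"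
    using gm hm by (simp add: nn_integral_add nn_integral_cmult)
  also have "(\<integral>\<^sup>+w. ennreal (g w) \<partial>(PiM ?S (\<lambda>_. lborel))) = moment_int j p B L ((1 + e) * s)"
  proof -
    have "(\<integral>\<^sup>+w. ennreal (g w) \<partial>(PiM ?S (\<lambda>_. lborel)))
      = (\<integral>\<^sup>+w. (\<integral>\<^sup>+t. ennreal (g (w(m := t))) \<partial>lborel) \<partial>(PiM (set L) (\<lambda>_. lborel)))"
      unfolding S using gm[unfolded S] by (intro product_nn_integral_insert m) auto
    also have "\<dots> = (\<integral>\<^sup>+w. ennreal (\<bar>w j\<bar> powr (2 * p)
        * gauss L w (\<lambda>k l. (1 + e) * s * B (zero_outside (set L) w) k l)) \<partial>(PiM (set L) (\<lambda>_. lborel)))"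
    proof (rule nn_integral_cong)
      fix w :: "'a \<Rightarrow> real"
      let ?D = "\<lambda>k l. (1 + e) * s * B (zero_outside (set L) w) k l"
      have D: "pos_def ?S ?D" using e s0 by (intro pos_def_scale[OF pd]) simp
      have "(\<integral>\<^sup>+t. ennreal (g (w(m := t))) \<partial>lborel)
        = (\<integral>\<^sup>+t. ennreal (\<bar>w j\<bar> powr (2 * p)) * ennreal (gauss (L @ [m]) (w(m := t)) ?D) \<partial>lborel)"
        unfolding g_def zo' using m by (simp add: ennreal_mult gauss_nonneg)
      also have "\<dots> = ennreal (\<bar>w j\<bar> powr (2 * p)) * (\<integral>\<^sup>+t. ennreal (gauss (L @ [m]) (w(m := t)) ?D) \<partial>lborel)"
      proof (rule nn_integral_cmult)
        have "(\<lambda>t. gauss (L @ [m]) (w(m := t)) ?D) \<in> borel_measurable borel"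
          by (intro borel_measurable_gauss) auto
        then show "(\<lambda>t. ennreal (gauss (L @ [m]) (w(m := t)) ?D)) \<in> borel_measurable lborel" by simp
      qed
      also have "\<dots> = ennreal (\<bar>w j\<bar> powr (2 * p)) * ennreal (gauss L w ?D)"
        by (simp only: nn_integral_gauss_snoc[OF D L])
      finally show "(\<integral>\<^sup>+t. ennreal (g (w(m := t))) \<partial>lborel)
          = ennreal (\<bar>w j\<bar> powr (2 * p) * gauss L w ?D)"
        by (simp add: ennreal_mult gauss_nonneg)
    qed
    finally show ?thesis by (simp only: moment_int_def)
  qed
  also have "(\<integral>\<^sup>+w. ennreal (h w) \<partial>(PiM ?S (\<lambda>_. lborel)))
    = ennreal (M * exp (- R\<^sup>2 / (4 * C')) * sqrt (pi / ?r) ^ card ?S)"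
    unfolding h_def using M s(3) by (intro nn_integral_PiM_exp_square) auto
  also have "card ?S = ?n" using L by (rule distinct_card)
  also have "M * exp (- R\<^sup>2 / (4 * C')) * sqrt (pi / ?r) ^ ?n
    = (8 * C' * (p + 1)) powr p * (1 / sqrt (2 * pi * c) * sqrt (pi / ?r)) ^ ?n * exp (- R\<^sup>2 / (4 * C'))"
    by (simp only: M_def power_mult_distrib mult_ac)
  also have "1 / sqrt (2 * pi * c) * sqrt (pi / ?r) = 2 * sqrt (C' / c)"
    by (rule gauss_normalization[OF c s(3)])
  finally show ?thesis .
qed

text \<open>The covariance still depends on \<open>w j\<close>, so the moment is dominated by a
  fixed Gaussian rather than evaluated.\<close>

lemma moment_int_singleton_le:
  fixes B :: "('a \<Rightarrow> real) \<Rightarrow> 'a \<Rightarrow> 'a \<Rightarrow> real"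
  assumes p: "0 \<le> p" and c: "0 < c" and ge: "\<And>w. c \<le> B w j j" and le: "\<And>w. B w j j \<le> C"
    and s: "1 \<le> s" "s * C \<le> C'" "0 < C'"
  shows "moment_int j p B [j] s \<le> ennreal ((8 * C' * (p + 1)) powr p * (2 * sqrt (C' / c)))"
proof -
  let ?r = "1 / (8 * C')" and ?M = "(8 * C' * (p + 1)) powr p * (1 / sqrt (2 * pi * c))"
  have M: "0 \<le> ?M" using c by simp
  have qf: "qf {j} A v = A j j * (v j)\<^sup>2" for A v by (simp add: qf_def power2_eq_square)
  have "\<bar>w j\<bar> powr (2 * p) * gauss [j] w (\<lambda>k l. s * B (zero_outside {j} w) k l)
    \<le> ?M * (\<Prod>i\<in>{j}. exp (- ?r * (w i)\<^sup>2))" for w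
  proof -
    let ?b = "B (zero_outside {j} w) j j"
    have b: "c \<le> ?b" "?b \<le> C" by (rule ge le)+
    have sb: "c \<le> s * ?b" using mult_mono[OF s(1) b(1)] s(1) c by simp
    have bs: "s * ?b \<le> C'" using mult_left_mono[OF b(2), of s] s by linarith
    have "\<bar>w j\<bar> powr (2 * p) * gauss [j] w (\<lambda>k l. s * B (zero_outside {j} w) k l)
      \<le> (8 * C' * (p + 1)) powr p * (1 / sqrt (2 * pi * c)) ^ length [j]
      * exp (- (\<Sum>k\<in>set [j]. (w k)\<^sup>2) / (4 * C')) * (\<Prod>i\<in>set [j]. exp (- ?r * (w i)\<^sup>2))"
    proof (rule moment_gauss_le[OF pos_defI_bound _ _ c s(3) p])
      show "c * (\<Sum>k\<in>set [j]. (v k)\<^sup>2) \<le> qf (set [j]) (\<lambda>k l. s * B (zero_outside {j} w) k l) v" for v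
        using mult_right_mono[OF sb, of "(v j)\<^sup>2"] by (simp add: qf)
      \<comment> \<open>The lower bound serves twice: for positive definiteness and as a hypothesis
        of the density bound.\<close>
      then show "c * (\<Sum>k\<in>set [j]. (v k)\<^sup>2) \<le> qf (set [j]) (\<lambda>k l. s * B (zero_outside {j} w) k l) v" for v .
      show "qf (set [j]) (\<lambda>k l. s * B (zero_outside {j} w) k l) v \<le> C' * (\<Sum>k\<in>set [j]. (v k)\<^sup>2)" for v
        using mult_right_mono[OF bs, of "(v j)\<^sup>2"] by (simp add: qf)
    qed (use c in auto)
    also have "\<dots> = ?M * exp (- (w j)\<^sup>2 / (4 * C')) * exp (- ?r * (w j)\<^sup>2)" by simp
    also have "\<dots> \<le> ?M * 1 * exp (- ?r * (w j)\<^sup>2)"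
      using M s(3) by (intro mult_right_mono mult_left_mono) auto
    finally show ?thesis by simp
  qed
  then have "moment_int j p B [j] s \<le> (\<integral>\<^sup>+w. ennreal (?M * (\<Prod>i\<in>{j}. exp (- ?r * (w i)\<^sup>2))) \<partial>(PiM {j} (\<lambda>_. lborel)))"
    unfolding moment_int_def list.set by (intro nn_integral_mono ennreal_leI) simp
  also have "\<dots> = ennreal (?M * sqrt (pi / ?r) ^ card {j})"
    using M s(3) by (intro nn_integral_PiM_exp_square) auto
  also have "?M * sqrt (pi / ?r) ^ card {j} = (8 * C' * (p + 1)) powr p * (1 / sqrt (2 * pi * c) * sqrt (pi / ?r))"
    by (simp only: is_singletonI is_singleton_altdef[THEN iffD1] power_one_right mult.assoc)
  also have "1 / sqrt (2 * pi * c) * sqrt (pi / ?r) = 2 * sqrt (C' / c)"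
    by (rule gauss_normalization[OF c s(3)])
  finally show ?thesis .
qed

text \<open>Apply |xy| <= (x^2 + y^2)/2 to each \<open>v k * v l\<close>; the free summation index
  produces \<open>card S\<close>. This is where an entrywise error loses one power of the
  dimension.\<close>

lemma qf_le_of_entries:
  assumes "\<And>k l. k \<in> S \<Longrightarrow> l \<in> S \<Longrightarrow> \<bar>B k l - B' k l\<bar> \<le> d"
  shows "qf S B v \<le> qf S B' v + d * real (card S) * (\<Sum>k\<in>S. (v k)\<^sup>2)"
proof -
  have "qf S B v - qf S B' v = (\<Sum>k\<in>S. \<Sum>l\<in>S. v k * (B k l - B' k l) * v l)"
    by (simp add: qf_def sum_subtractf right_diff_distrib left_diff_distrib)
  also have "\<dots> \<le> (\<Sum>k\<in>S. \<Sum>l\<in>S. d * (((v k)\<^sup>2 + (v l)\<^sup>2) / 2))"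
  proof (intro sum_mono)
    fix k l assume kl: "k \<in> S" "l \<in> S"
    have "v k * (B k l - B' k l) * v l \<le> \<bar>B k l - B' k l\<bar> * \<bar>v k * v l\<bar>"
      by (metis abs_ge_self abs_mult mult.assoc mult.commute)
    also have "\<dots> \<le> d * (((v k)\<^sup>2 + (v l)\<^sup>2) / 2)"
    proof (rule mult_mono[OF assms[OF kl]])
      have "0 \<le> (\<bar>v k\<bar> - \<bar>v l\<bar>)\<^sup>2" by simp
      then show "\<bar>v k * v l\<bar> \<le> ((v k)\<^sup>2 + (v l)\<^sup>2) / 2"
        by (simp add: power2_diff abs_mult)
      show "0 \<le> d" using assms[OF kl] by linarith
    qed simp
    finally show "v k * (B k l - B' k l) * v l \<le> d * (((v k)\<^sup>2 + (v l)\<^sup>2) / 2)" .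
  qed
  also have "\<dots> = d * real (card S) * (\<Sum>k\<in>S. (v k)\<^sup>2)"
    by (simp add: sum_distrib_left[symmetric] sum_divide_distrib[symmetric] sum.distrib)
  finally show ?thesis by simp
qed

text \<open>Eventually \<open>q * sqrt (real m)\<close> exceeds \<open>ln Y + 1\<close>, so the
  exponential beats the geometric growth with a factor \<open>exp (- 1) ^ m\<close> to
  spare.\<close>

lemma summable_geometric_times_exp_neg:
  fixes Y q :: real
  assumes Y: "1 \<le> Y" and q: "0 < q"
  shows "summable (\<lambda>m::nat. Y ^ (m + 1) * exp (- q * (real m * sqrt (real m))))"
proof (rule summable_comparison_test_ev)
  show "summable (\<lambda>m. Y * exp (- 1) ^ m)"
    by (intro summable_mult summable_geometric) simp
  have "\<forall>\<^sub>F m::nat in sequentially. sqrt (real m) \<ge> (ln Y + 1) / q"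
    using filterlim_compose[OF sqrt_at_top filterlim_real_sequentially]
    by (simp add: filterlim_at_top)
  then show "\<forall>\<^sub>F m in sequentially. norm (Y ^ (m + 1) * exp (- q * (real m * sqrt (real m)))) \<le> Y * exp (- 1) ^ m"
  proof eventually_elim
    case (elim m)
    have "ln Y + 1 \<le> q * sqrt (real m)" using elim q by (simp add: field_simps)
    then have "real m * (ln Y + 1) \<le> real m * (q * sqrt (real m))" by (rule mult_left_mono) simp
    then have "real m * ln Y + - q * (real m * sqrt (real m)) \<le> real m * - 1" by (simp add: algebra_simps)
    then have "exp (real m * ln Y) * exp (- q * (real m * sqrt (real m))) \<le> exp (real m * - 1)"
      by (simp add: exp_add[symmetric])
    moreover have "exp (real m * ln Y) = Y ^ m" using Y by (simp add: exp_of_nat_mult)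
    moreover have "exp (real m * - 1) = exp (- 1 :: real) ^ m" by (rule exp_of_nat_mult)
    ultimately have "Y ^ m * exp (- q * (real m * sqrt (real m))) \<le> exp (- 1) ^ m" by simp
    then have "Y * (Y ^ m * exp (- q * (real m * sqrt (real m)))) \<le> Y * exp (- 1) ^ m"
      using Y by (intro mult_left_mono) auto
    then show ?case using Y by (simp add: mult.assoc)
  qed
qed

text \<open>The constant is fixed before \<open>K\<close>, \<open>j\<close> and \<open>B\<close>.
  Removing coordinate \<open>m\<close> multiplies the bound by at most \<open>exp (E1 m)\<close> and
  adds \<open>\<tau> m\<close>; both series converge.\<close>

lemma moment_int_bounded:
  fixes c C p \<eta> :: real
  assumes c: "0 < c" and cC: "c \<le> C" and p: "0 \<le> p" and \<eta>: "0 \<le> \<eta>"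
  obtains c1 where "0 \<le> c1" and
    "\<And>K j B. j \<in> idx K \<Longrightarrow>
      (\<And>k l. k \<in> idx K \<Longrightarrow> l \<in> idx K \<Longrightarrow> (\<lambda>w. B w k l) \<in> borel_measurable (PiM UNIV (\<lambda>_. borel))) \<Longrightarrow>
      (\<And>w k l. k \<in> idx K \<Longrightarrow> l \<in> idx K \<Longrightarrow> B w k l = B w l k) \<Longrightarrow>
      (\<And>w v. c * (\<Sum>k\<in>idx K. (v k)\<^sup>2) \<le> qf (idx K) (B w) v) \<Longrightarrow>
      (\<And>w v. qf (idx K) (B w) v \<le> C * (\<Sum>k\<in>idx K. (v k)\<^sup>2)) \<Longrightarrow>
      (\<And>w m k l. m \<in> idx K \<Longrightarrow> k \<in> idx K \<Longrightarrow> l \<in> idx K \<Longrightarrow> \<bar>w m\<bar> \<le> real m powr (3/4) \<Longrightarrow>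
        \<bar>B w k l - B (w(m := 0)) k l\<bar> \<le> \<eta> * real m powr (- (13/4))) \<Longrightarrow>
      moment_int j p B (j # sorted_list_of_set (idx K - {j})) 1 \<le> ennreal c1"
proof -
  \<comment> \<open>The entrywise error \<open>\<eta> * real m powr (- (13/4))\<close> times the
    dimension bound \<open>m + 1 \<le> 2 * m\<close>, divided by the ellipticity constant
    \<open>c\<close> to become a relative error.\<close>
  define e where "e m = 2 * \<eta> / c * real m powr (- (9/4))" for m :: nat
  have e0: "0 \<le> e m" for m using c \<eta> by (simp add: e_def)
  \<comment> \<open>By 1 + x <= exp x, the factor \<open>(1 + e m) ^ (m + 1)\<close> is at most
    \<open>exp (E1 m)\<close>.\<close>
  define E1 where "E1 m = (real m + 1) * e m" for m
  have E10: "0 \<le> E1 m" for m using e0 by (simp add: E1_def)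
  have se: "summable e"
    unfolding e_def by (intro summable_mult) (simp add: summable_real_powr_iff)
  have base: "real m * real m powr a = real m powr (1 + a)" for m a
    by (rule powr_mult_base) simp
  have "E1 = (\<lambda>m. 2 * \<eta> / c * real m powr (- (5/4)) + e m)"
  proof
    fix m
    have "E1 m = 2 * \<eta> / c * (real m * real m powr (- (9/4))) + e m"
      by (simp add: E1_def e_def distrib_right add_divide_distrib)
    then show "E1 m = 2 * \<eta> / c * real m powr (- (5/4)) + e m"
      by (simp add: base)
  qed
  moreover have "summable (\<lambda>m. 2 * \<eta> / c * real m powr (- (5/4)) + e m)"
    by (intro summable_add se summable_mult) (simp add: summable_real_powr_iff)
  ultimately have sE1: "summable E1" by (simp only:)
  \<comment> \<open>Bounds the product of all factors \<open>1 + e m\<close>, hence every scalar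
    inflation that can occur.\<close>
  define S0 where "S0 = exp (suminf e)"
  define C' where "C' = S0 * C"
  have C: "0 < C" using c cC by linarith
  have C': "0 < C'" using C by (simp add: C'_def S0_def)
  \<comment> \<open>At least 1, so that a power with a smaller exponent may be raised to the
    exponent \<open>m + 1\<close>.\<close>
  define Y where "Y = max 1 (2 * sqrt (C' / c))"
  have Y: "1 \<le> Y" "2 * sqrt (C' / c) \<le> Y" "0 \<le> 2 * sqrt (C' / c)"
    using c C' by (auto simp: Y_def)
  define M where "M = (8 * C' * (p + 1)) powr p"
  have M: "0 \<le> M" by (simp add: M_def)
  define \<tau> where "\<tau> m = M * (Y ^ (m + 1) * exp (- (1 / (4 * C')) * (real m * sqrt (real m))))" for m :: nat
  have \<tau>0: "0 \<le> \<tau> m" for m using M Y by (simp add: \<tau>_def)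
  have s\<tau>: "summable \<tau>"
    unfolding \<tau>_def using C' by (intro summable_mult summable_geometric_times_exp_neg Y) simp
  define c1 where "c1 = exp (suminf E1) * (M * Y + suminf \<tau>)"
  show ?thesis
  proof (rule that[of c1])
    show "0 \<le> c1"
      using M Y suminf_nonneg[OF s\<tau> \<tau>0] by (simp add: c1_def)
  next
    fix K :: nat and j :: nat and B :: "(nat \<Rightarrow> real) \<Rightarrow> nat \<Rightarrow> nat \<Rightarrow> real"
    assume j: "j \<in> idx K"
      and meas: "\<And>k l. k \<in> idx K \<Longrightarrow> l \<in> idx K \<Longrightarrow> (\<lambda>w. B w k l) \<in> borel_measurable (PiM UNIV (\<lambda>_. borel))"
      and sym: "\<And>w k l. k \<in> idx K \<Longrightarrow> l \<in> idx K \<Longrightarrow> B w k l = B w l k"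
      and ge: "\<And>w v. c * (\<Sum>k\<in>idx K. (v k)\<^sup>2) \<le> qf (idx K) (B w) v"
      and le: "\<And>w v. qf (idx K) (B w) v \<le> C * (\<Sum>k\<in>idx K. (v k)\<^sup>2)"
      and near: "\<And>w m k l. m \<in> idx K \<Longrightarrow> k \<in> idx K \<Longrightarrow> l \<in> idx K \<Longrightarrow> \<bar>w m\<bar> \<le> real m powr (3/4) \<Longrightarrow>
        \<bar>B w k l - B (w(m := 0)) k l\<bar> \<le> \<eta> * real m powr (- (13/4))"
    have sub: "(\<Sum>k\<in>T. (v k)\<^sup>2) = (\<Sum>k\<in>idx K. (if k \<in> T then v k else 0)\<^sup>2)" if "T \<subseteq> idx K" for T and v :: "nat \<Rightarrow> real"
      using that by (intro sum.mono_neutral_cong_left) auto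
    have geT: "c * (\<Sum>k\<in>T. (v k)\<^sup>2) \<le> qf T (B w) v" if "T \<subseteq> idx K" for T w v
      unfolding sub[OF that] qf_subset[OF that finite_idx] by (rule ge)
    have leT: "qf T (B w) v \<le> C * (\<Sum>k\<in>T. (v k)\<^sup>2)" if "T \<subseteq> idx K" for T w v
      unfolding sub[OF that] qf_subset[OF that finite_idx] by (rule le)
    have nearT: "qf T B1 v \<le> (1 + e m) * qf T B2 v"
      if T: "T \<subseteq> idx K" "card T \<le> m + 1" and m: "m \<in> idx K"
        and d: "\<And>k l. k \<in> T \<Longrightarrow> l \<in> T \<Longrightarrow> \<bar>B1 k l - B2 k l\<bar> \<le> \<eta> * real m powr (- (13/4))"
        and ge2: "c * (\<Sum>k\<in>T. (v k)\<^sup>2) \<le> qf T B2 v" for T m B1 B2 v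
    proof -
      have m1: "1 \<le> real m" using m by (simp add: idx_def)
      have "qf T B1 v \<le> qf T B2 v + \<eta> * real m powr (- (13/4)) * real (card T) * (\<Sum>k\<in>T. (v k)\<^sup>2)"
        by (rule qf_le_of_entries[OF d])
      also have "\<eta> * real m powr (- (13/4)) * real (card T) * (\<Sum>k\<in>T. (v k)\<^sup>2)
        \<le> \<eta> * real m powr (- (13/4)) * (2 * real m) * (\<Sum>k\<in>T. (v k)\<^sup>2)"
        using T(2) m1 \<eta> by (intro mult_right_mono mult_left_mono sum_nonneg) auto
      also have "\<eta> * real m powr (- (13/4)) * (2 * real m) = e m * c"
      proof -
        have "\<eta> * real m powr (- (13/4)) * (2 * real m) = 2 * \<eta> * (real m * real m powr (- (13/4)))"
          by simp
        then show ?thesis using c by (simp add: base e_def)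
      qed
      also have "e m * c * (\<Sum>k\<in>T. (v k)\<^sup>2) \<le> e m * qf T B2 v"
        unfolding mult.assoc using ge2 e0 by (rule mult_left_mono)
      finally show ?thesis by (simp add: algebra_simps)
    qed
    \<comment> \<open>The last condition is a budget: the inflation already spent times all that may
      still come stays below \<open>S0\<close>. Sortedness makes the removed \<open>m\<close> exceed
      the rest of \<open>L\<close>.\<close>
    have claim: "moment_int j p B (j # L) s
        \<le> ennreal (exp (\<Sum>m\<in>set L. E1 m) * (M * Y + (\<Sum>m\<in>set L. \<tau> m)))"
      if "sorted_wrt (<) L" "set L \<subseteq> idx K - {j}" "1 \<le> s" "s * exp (\<Sum>m\<in>set L. e m) \<le> S0" for L s
      using that
    proof (induction L arbitrary: s rule: rev_induct)
      case Nil
      have qfj: "qf {j} A (\<lambda>_. 1) = A j j" for A by (simp add: qf_def)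
      have "s * C \<le> C'" using Nil(4) C by (simp add: C'_def)
      then have "moment_int j p B [j] s \<le> ennreal (M * (2 * sqrt (C' / c)))"
        unfolding M_def
        using geT[of "{j}" "\<lambda>_. 1"] leT[of "{j}" _ "\<lambda>_. 1"] j
        by (intro moment_int_singleton_le[OF p c _ _ Nil(3) _ C']) (simp_all add: qfj)
      also have "\<dots> \<le> ennreal (M * Y)"
        using M Y by (intro ennreal_leI mult_left_mono)
      finally show ?case by simp
    next
      case (snoc m L)
      have lt: "\<And>x. x \<in> set L \<Longrightarrow> x < m" and sL: "sorted_wrt (<) L"
        using snoc.prems(1) by (auto simp: sorted_wrt_append)
      have dL: "distinct (L @ [m])"
        using snoc.prems(1) by (simp add: strict_sorted_iff del: distinct_append)
      have m: "m \<in> idx K" "m \<noteq> j" and sLj: "set L \<subseteq> idx K - {j}" using snoc.prems(2) by auto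
      have mL: "m \<notin> set L" using dL by simp
      have dj: "distinct ((j # L) @ [m])" using dL snoc.prems(2) by auto
      have subK: "set ((j # L) @ [m]) \<subseteq> idx K" using snoc.prems(2) j by auto
      let ?T = "set ((j # L) @ [m])" and ?n = "length ((j # L) @ [m])"
      have "set (L @ [m]) \<subseteq> {1..m}" using snoc.prems(2) lt by (force simp: idx_def)
      then have "card (set (L @ [m])) \<le> m" using card_mono[of "{1..m}"] by fastforce
      \<comment> \<open>\<open>L @ [m]\<close> lies in \<open>{1..m}\<close>; the extra 1 accounts
        for \<open>j\<close>, which may exceed \<open>m\<close>.\<close>
      then have n: "?n \<le> m + 1" using distinct_card[OF dL] by simp
      have cT: "card ?T \<le> m + 1" using n distinct_card[OF dj] by simp
      let ?R = "real m powr (3/4)"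
      have R2: "?R\<^sup>2 = real m * sqrt (real m)"
      proof -
        have "?R\<^sup>2 = real m powr (1 + 1/2)" by (simp add: power2_eq_square powr_add[symmetric])
        also have "\<dots> = real m * sqrt (real m)" by (simp only: base[symmetric] powr_half_sqrt of_nat_0_le_iff)
        finally show ?thesis .
      qed
      have exps: "exp (\<Sum>k\<in>set (L @ [m]). e k) = exp (e m) * exp (\<Sum>k\<in>set L. e k)"
        using mL by (simp add: exp_add)
      have e1: "1 + e m \<le> exp (e m)" by (rule exp_ge_add_one_self)
      have s1: "1 \<le> (1 + e m) * s" using mult_mono[of 1 "1 + e m" 1 s] e0[of m] snoc.prems(3) by simp
      have "(1 + e m) * s * exp (\<Sum>k\<in>set L. e k) \<le> exp (e m) * s * exp (\<Sum>k\<in>set L. e k)"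
        using e1 snoc.prems(3) by (intro mult_right_mono) auto
      also have "\<dots> \<le> S0" using snoc.prems(4) unfolding exps by (simp add: mult_ac)
      finally have sS: "(1 + e m) * s * exp (\<Sum>k\<in>set L. e k) \<le> S0" .
      have "0 \<le> (\<Sum>k\<in>set (L @ [m]). e k)" by (intro sum_nonneg e0)
      then have "s * 1 \<le> s * exp (\<Sum>k\<in>set (L @ [m]). e k)"
        using snoc.prems(3) by (intro mult_left_mono) auto
      then have "s \<le> S0" using snoc.prems(4) by linarith
      then have sC: "s * C \<le> C'" using C by (simp add: C'_def)
      have meas': "(\<lambda>w. B w k l) \<in> borel_measurable (PiM UNIV (\<lambda>_. borel))" if "k \<in> ?T" "l \<in> ?T" for k l
        using that by (intro meas subsetD[OF subK])
      have sym': "B w k l = B w l k" if "k \<in> ?T" "l \<in> ?T" for w k l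
        using that by (intro sym subsetD[OF subK])
      have "moment_int j p B ((j # L) @ [m]) s
        \<le> ennreal ((1 + e m) ^ ?n) * moment_int j p B (j # L) ((1 + e m) * s)
        + ennreal ((8 * C' * (p + 1)) powr p * (2 * sqrt (C' / c)) ^ ?n * exp (- ?R\<^sup>2 / (4 * C')))"
      proof (rule moment_int_step[OF meas' dj _ p sym' c geT[OF subK] leT[OF subK] e0 _ _ _ snoc.prems(3) sC C'])
        fix w :: "nat \<Rightarrow> real" and v assume w: "\<bar>w m\<bar> \<le> ?R"
        have near': "\<bar>B w k l - B (w(m := 0)) k l\<bar> \<le> \<eta> * real m powr (- (13/4))"
          if "k \<in> ?T" "l \<in> ?T" for k l
          using near[where w = w and m = m and k = k and l = l] m(1) w that subK by blast
        show "qf ?T (B w) v \<le> (1 + e m) * qf ?T (B (w(m := 0))) v"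
          by (rule nearT[OF subK cT m(1) near' geT[OF subK]])
        show "qf ?T (B (w(m := 0))) v \<le> (1 + e m) * qf ?T (B w) v"
          by (rule nearT[OF subK cT m(1) _ geT[OF subK]]) (subst abs_minus_commute, rule near')
      qed simp_all
      also have "\<dots> \<le> ennreal (exp (E1 m)) * ennreal (exp (\<Sum>k\<in>set L. E1 k) * (M * Y + (\<Sum>k\<in>set L. \<tau> k))) + ennreal (\<tau> m)"
      proof (intro add_mono mult_mono snoc.IH[OF sL sLj s1 sS])
        have "(1 + e m) ^ ?n \<le> exp (e m) ^ ?n" using e0[of m] e1 by (intro power_mono) auto
        also have "\<dots> = exp (real ?n * e m)" by (rule exp_of_nat_mult[symmetric])
        also have "\<dots> \<le> exp (E1 m)"
        proof -
          have "real ?n \<le> real m + 1" using n by linarith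
          then have "real ?n * e m \<le> (real m + 1) * e m" using e0 by (rule mult_right_mono)
          then show ?thesis by (simp add: E1_def)
        qed
        finally show "ennreal ((1 + e m) ^ ?n) \<le> ennreal (exp (E1 m))" by (rule ennreal_leI)
        have "(2 * sqrt (C' / c)) ^ ?n \<le> Y ^ ?n" using Y by (intro power_mono) auto
        also have "\<dots> \<le> Y ^ (m + 1)" using Y n by (intro power_increasing) auto
        finally have "(8 * C' * (p + 1)) powr p * (2 * sqrt (C' / c)) ^ ?n * exp (- ?R\<^sup>2 / (4 * C'))
          \<le> M * Y ^ (m + 1) * exp (- ?R\<^sup>2 / (4 * C'))"
          unfolding M_def by (intro mult_right_mono mult_left_mono) auto
        also have "\<dots> = \<tau> m" unfolding \<tau>_def R2 by simp
        finally show "ennreal ((8 * C' * (p + 1)) powr p * (2 * sqrt (C' / c)) ^ ?n * exp (- ?R\<^sup>2 / (4 * C')))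
          \<le> ennreal (\<tau> m)" by (rule ennreal_leI)
      qed auto
      also have "\<dots> = ennreal (exp (E1 m) * (exp (\<Sum>k\<in>set L. E1 k) * (M * Y + (\<Sum>k\<in>set L. \<tau> k))) + \<tau> m)"
      proof -
        have "0 \<le> exp (\<Sum>k\<in>set L. E1 k) * (M * Y + (\<Sum>k\<in>set L. \<tau> k))"
          using M Y \<tau>0 by (intro mult_nonneg_nonneg add_nonneg_nonneg sum_nonneg) auto
        then show ?thesis using \<tau>0 by (simp add: ennreal_mult ennreal_plus)
      qed
      also have "\<dots> \<le> ennreal (exp (\<Sum>k\<in>set (L @ [m]). E1 k) * (M * Y + (\<Sum>k\<in>set (L @ [m]). \<tau> k)))"
      proof (rule ennreal_leI)
        let ?x = "exp (\<Sum>k\<in>set (L @ [m]). E1 k)"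
        have x: "?x = exp (E1 m) * exp (\<Sum>k\<in>set L. E1 k)"
          using mL by (simp add: exp_add)
        have "0 \<le> (\<Sum>k\<in>set (L @ [m]). E1 k)" by (intro sum_nonneg E10)
        \<comment> \<open>As the exponential factor is at least 1, the new tail term may be placed
          under it.\<close>
        then have "\<tau> m \<le> ?x * \<tau> m" using mult_right_mono[of 1 ?x "\<tau> m"] \<tau>0 by simp
        moreover have "(\<Sum>k\<in>set (L @ [m]). \<tau> k) = \<tau> m + (\<Sum>k\<in>set L. \<tau> k)" using mL by simp
        ultimately show "exp (E1 m) * (exp (\<Sum>k\<in>set L. E1 k) * (M * Y + (\<Sum>k\<in>set L. \<tau> k))) + \<tau> m
          \<le> ?x * (M * Y + (\<Sum>k\<in>set (L @ [m]). \<tau> k))"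
          unfolding x by (simp add: algebra_simps)
      qed
      finally show ?case by simp
    qed
    let ?L = "sorted_list_of_set (idx K - {j})"
    have "1 * exp (\<Sum>m\<in>set ?L. e m) \<le> S0"
      using sum_le_suminf[OF se finite_set[of ?L]] e0 by (simp add: S0_def)
    then have "moment_int j p B (j # ?L) 1 \<le> ennreal (exp (\<Sum>m\<in>set ?L. E1 m) * (M * Y + (\<Sum>m\<in>set ?L. \<tau> m)))"
      by (intro claim) auto
    also have "\<dots> \<le> ennreal c1"
      unfolding c1_def
      using sum_le_suminf[OF sE1 finite_set[of ?L]] E10 sum_le_suminf[OF s\<tau> finite_set[of ?L]] \<tau>0 M Y
      by (intro ennreal_leI mult_mono add_mono) (auto intro!: add_nonneg_nonneg sum_nonneg)
    finally show "moment_int j p B (j # ?L) 1 \<le> ennreal c1" .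
  qed
qed

section \<open>The covariance of the Ornstein-Uhlenbeck setting\<close>

lemma gauss_cong:
  assumes "\<And>i. i \<in> set L \<Longrightarrow> w i = w' i"
    and "\<And>i j. i \<in> set L \<Longrightarrow> j \<in> set L \<Longrightarrow> B i j = B' i j"
  shows "gauss L w B = gauss L w' B'"
  using assms
proof (induction L arbitrary: w w' B B')
  case (Cons i L)
  have "gauss L (\<lambda>k. w k - B k i / B i i * w i) (schur i B)
      = gauss L (\<lambda>k. w' k - B' k i / B' i i * w' i) (schur i B')"
    by (rule Cons.IH) (simp_all add: Cons.prems schur_def)
  then show ?case by (simp add: Cons.prems)
qed simp

text \<open>One-dimensional scaling and Fubini, coordinate by coordinate. The restriction to
  \<open>S\<close> keeps the scaled point extensional, as membership in the product space
  demands.\<close>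

lemma nn_integral_PiM_scale:
  fixes f :: "('a \<Rightarrow> real) \<Rightarrow> ennreal"
  assumes "finite S" and "\<And>i. i \<in> S \<Longrightarrow> 0 < c i"
    and "f \<in> borel_measurable (PiM S (\<lambda>_. lborel))"
  shows "(\<integral>\<^sup>+w. f w \<partial>(PiM S (\<lambda>_. lborel)))
    = ennreal (\<Prod>i\<in>S. c i) * (\<integral>\<^sup>+w. f (\<lambda>i\<in>S. c i * w i) \<partial>(PiM S (\<lambda>_. lborel)))"
  using assms
proof (induction S arbitrary: f)
  case empty
  show ?case by (simp add: PiM_empty nn_integral_count_space_finite restrict_def)
next
  case (insert i T)
  interpret product_sigma_finite "\<lambda>_. lborel :: real measure"
    by (rule product_sigma_finite.intro) (rule sigma_finite_lborel)
  have ci: "0 < c i" using insert.prems(1) by simp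
  have P: "0 \<le> (\<Prod>i\<in>T. c i)" using insert.prems(1) by (intro prod_nonneg) (auto simp: less_imp_le)
  have upd: "(\<lambda>(w, s). w(i := c i * s)) \<in> measurable (PiM T (\<lambda>_. lborel) \<Otimes>\<^sub>M lborel) (PiM (insert i T) (\<lambda>_. lborel))"
  proof -
    have "(\<lambda>(w, s). (w, c i * s)) \<in> measurable (PiM T (\<lambda>_. lborel :: real measure) \<Otimes>\<^sub>M lborel) (PiM T (\<lambda>_. lborel) \<Otimes>\<^sub>M lborel)"
      by measurable
    from measurable_comp[OF this measurable_add_dim[where M = "\<lambda>_. lborel"]] show ?thesis
      by (simp add: comp_def case_prod_beta)
  qed
  have meas1: "(\<lambda>(w, s). f (w(i := c i * s))) \<in> borel_measurable (PiM T (\<lambda>_. lborel) \<Otimes>\<^sub>M lborel)"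
    using measurable_comp[OF upd insert.prems(2)] by (simp add: comp_def case_prod_beta)
  define F where "F w = (\<integral>\<^sup>+s. f (w(i := c i * s)) \<partial>lborel)" for w
  have F: "F \<in> borel_measurable (PiM T (\<lambda>_. lborel))"
    unfolding F_def[abs_def] by (rule lborel.borel_measurable_nn_integral[OF meas1])
  define restr where "restr w = (\<lambda>k\<in>insert i T. c k * w k)" for w
  have restr: "restr \<in> measurable (PiM (insert i T) (\<lambda>_. lborel)) (PiM (insert i T) (\<lambda>_. lborel))"
    unfolding restr_def[abs_def] by measurable
  have "(\<integral>\<^sup>+w. f w \<partial>(PiM (insert i T) (\<lambda>_. lborel)))
    = (\<integral>\<^sup>+w. (\<integral>\<^sup>+s. f (w(i := s)) \<partial>lborel) \<partial>(PiM T (\<lambda>_. lborel)))"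
    by (rule product_nn_integral_insert[OF insert.hyps insert.prems(2)])
  also have "\<dots> = (\<integral>\<^sup>+w. ennreal (c i) * F w \<partial>(PiM T (\<lambda>_. lborel)))"
  proof (rule nn_integral_cong)
    fix w assume w: "w \<in> space (PiM T (\<lambda>_. lborel :: real measure))"
    have "(\<lambda>s. f (w(i := s))) \<in> borel_measurable lborel"
      using measurable_comp[OF measurable_comp[OF measurable_Pair1'[OF w] measurable_add_dim[where M = "\<lambda>_. lborel"]] insert.prems(2)]
      by (simp add: comp_def)
    then have "(\<integral>\<^sup>+s. f (w(i := s)) \<partial>lborel) = ennreal \<bar>c i\<bar> * (\<integral>\<^sup>+s. f (w(i := 0 + c i * s)) \<partial>lborel)"
      using ci by (intro nn_integral_real_affine) auto
    then show "(\<integral>\<^sup>+s. f (w(i := s)) \<partial>lborel) = ennreal (c i) * F w"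
      using ci by (simp add: F_def)
  qed
  also have "\<dots> = ennreal (c i) * (\<integral>\<^sup>+w. F w \<partial>(PiM T (\<lambda>_. lborel)))"
    by (rule nn_integral_cmult[OF F])
  also have "(\<integral>\<^sup>+w. F w \<partial>(PiM T (\<lambda>_. lborel)))
    = ennreal (\<Prod>i\<in>T. c i) * (\<integral>\<^sup>+w. F (\<lambda>i\<in>T. c i * w i) \<partial>(PiM T (\<lambda>_. lborel)))"
    using insert.prems(1) by (intro insert.IH F) auto
  also have "(\<integral>\<^sup>+w. F (\<lambda>i\<in>T. c i * w i) \<partial>(PiM T (\<lambda>_. lborel)))
    = (\<integral>\<^sup>+w. (\<integral>\<^sup>+s. f (restr (w(i := s))) \<partial>lborel) \<partial>(PiM T (\<lambda>_. lborel)))"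
  proof -
    have "(\<lambda>k\<in>T. c k * w k)(i := c i * s) = restr (w(i := s))" for w s
      using insert.hyps(2) by (auto simp: restr_def fun_eq_iff restrict_def)
    then show ?thesis by (simp add: F_def)
  qed
  also have "\<dots> = (\<integral>\<^sup>+w. f (restr w) \<partial>(PiM (insert i T) (\<lambda>_. lborel)))"
    using measurable_comp[OF restr insert.prems(2)]
    by (intro product_nn_integral_insert[OF insert.hyps, symmetric]) (simp add: comp_def)
  finally show ?case
    by (simp only: restr_def prod.insert[OF insert.hyps] ennreal_mult[OF less_imp_le[OF ci] P] mult.assoc)
qed

text \<open>Changing the coordinates in \<open>S\<close> one at a time telescopes into a modulus of
  continuity for the product topology; \<open>dep\<close> lets the remaining coordinates be ignored.
  Borel measurability of the entries of \<open>a\<close> is derived from this.\<close>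

lemma continuous_on_coordinatewise_holder:
  fixes f :: "('a \<Rightarrow> real) \<Rightarrow> real"
  assumes S: "finite S" and al: "0 < \<alpha>"
    and holder: "\<And>w k s. k \<in> S \<Longrightarrow> \<bar>f (w(k := s)) - f w\<bar> \<le> C k * \<bar>s - w k\<bar> powr \<alpha>"
    and dep: "\<And>w w'. (\<And>k. k \<in> S \<Longrightarrow> w k = w' k) \<Longrightarrow> f w = f w'"
  shows "continuous_on UNIV f"
proof -
  have tele: "\<bar>f (\<lambda>i. if i \<in> T then w' i else w i) - f w\<bar> \<le> (\<Sum>k\<in>T. C k * \<bar>w' k - w k\<bar> powr \<alpha>)"
    if "finite T" "T \<subseteq> S" for T w w'
    using that
  proof (induction T)
    case (insert k T)
    let ?u = "\<lambda>i. if i \<in> T then w' i else w i"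
    have u: "(\<lambda>i. if i \<in> insert k T then w' i else w i) = ?u(k := w' k)"
      by (simp add: fun_eq_iff)
    have "\<bar>f (?u(k := w' k)) - f ?u\<bar> \<le> C k * \<bar>w' k - ?u k\<bar> powr \<alpha>"
      using insert.prems by (intro holder) simp
    also have "?u k = w k" using insert.hyps by simp
    finally have "\<bar>f (?u(k := w' k)) - f ?u\<bar> \<le> C k * \<bar>w' k - w k\<bar> powr \<alpha>" .
    moreover have "\<bar>f ?u - f w\<bar> \<le> (\<Sum>k\<in>T. C k * \<bar>w' k - w k\<bar> powr \<alpha>)"
      using insert.prems by (intro insert.IH) simp
    ultimately show ?case unfolding u sum.insert[OF insert.hyps] by linarith
  qed simp
  have bound: "\<bar>f w' - f w\<bar> \<le> (\<Sum>k\<in>S. C k * \<bar>w' k - w k\<bar> powr \<alpha>)" for w w'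
  proof -
    have "f w' = f (\<lambda>i. if i \<in> S then w' i else w i)" by (rule dep) simp
    then show ?thesis using tele[OF S order.refl, of w' w] by simp
  qed
  have "(f \<longlongrightarrow> f w) (at w)" for w
  proof -
    have "((\<lambda>w'. w' k) \<longlongrightarrow> w k) (at w)" for k
      using continuous_on_product_coordinates[of k] by (auto simp: continuous_on_def)
    then have "((\<lambda>w'. \<bar>w' k - w k\<bar>) \<longlongrightarrow> 0) (at w)" for k
      by (simp add: LIM_zero tendsto_rabs_zero)
    then have "((\<lambda>w'. \<bar>w' k - w k\<bar> powr \<alpha>) \<longlongrightarrow> 0) (at w)" for k
      using al by (intro tendsto_zero_powrI[where b = \<alpha>]) auto
    then have "((\<lambda>w'. \<Sum>k\<in>S. C k * \<bar>w' k - w k\<bar> powr \<alpha>) \<longlongrightarrow> 0) (at w)"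
      by (intro tendsto_null_sum tendsto_mult_right_zero)
    then have "((\<lambda>w'. f w' - f w) \<longlongrightarrow> 0) (at w)"
      by (rule Lim_null_comparison[rotated]) (simp add: bound)
    then show ?thesis by (rule LIM_zero_cancel)
  qed
  then show ?thesis by (simp add: continuous_on_def)
qed

section \<open>The covariance at time \<open>t\<close> and its normalisation\<close>

lemma integral_exp_neg:
  fixes b t :: real
  assumes "0 < b" "0 \<le> t"
  shows "((\<lambda>s. exp (- b * s)) has_integral (1 - exp (- b * t)) / b) {0..t}"
proof -
  have "((\<lambda>s. exp (- b * s)) has_integral (- exp (- b * t) / b) - (- exp (- b * 0) / b)) {0..t}"
    using assms
    by (intro fundamental_theorem_of_calculus)
      (auto intro!: derivative_eq_intros simp: has_real_derivative_iff_has_vector_derivative[symmetric])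
  then show ?thesis by (simp add: diff_divide_distrib)
qed

lemma weighted_AM_GM:
  fixes r s x y :: real
  assumes "0 < r" "0 < s"
  shows "x * y \<le> s / (2 * r) * x\<^sup>2 + r / (2 * s) * y\<^sup>2"
proof -
  have "0 \<le> (s * x - r * y)\<^sup>2" by simp
  then have "2 * (r * s) * (x * y) \<le> s\<^sup>2 * x\<^sup>2 + r\<^sup>2 * y\<^sup>2"
    by (simp add: power2_diff power_mult_distrib mult_ac)
  also have "\<dots> = 2 * (r * s) * (s / (2 * r) * x\<^sup>2 + r / (2 * s) * y\<^sup>2)"
    using assms by (simp add: distrib_left power2_eq_square)
  finally show ?thesis using assms by (subst (asm) mult_le_cancel_left_pos) auto
qed

locale ou_covariance =
  fixes K :: nat and \<Lambda>0 \<Lambda>1 kappa_l kappa_b \<alpha> \<beta> :: real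
    and lam :: "nat \<Rightarrow> real" and a :: "(nat \<Rightarrow> real) \<Rightarrow> nat \<Rightarrow> nat \<Rightarrow> real" and t :: real
  assumes setting: "setting K \<Lambda>0 \<Lambda>1 kappa_l kappa_b \<alpha> \<beta> lam a" and t: "0 < t"
begin

abbreviation "g \<equiv> gdiag lam t"
abbreviation "S \<equiv> idx K"

lemma \<Lambda>0_pos: "0 < \<Lambda>0" and kappa_l_pos: "0 < kappa_l"
  using setting by (auto simp: setting_def)

lemma lam_ge: "i \<in> S \<Longrightarrow> kappa_l * (real i)\<^sup>2 \<le> lam i"
  using setting by (auto simp: setting_def)

lemma lam_pos: "i \<in> S \<Longrightarrow> 0 < lam i"
proof -
  assume i: "i \<in> S"
  then have "0 < kappa_l * (real i)\<^sup>2" using kappa_l_pos by (simp add: idx_def)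
  then show ?thesis using lam_ge[OF i] by linarith
qed

lemma a_sym: "i \<in> S \<Longrightarrow> j \<in> S \<Longrightarrow> a y i j = a y j i"
  using setting unfolding setting_def by blast

lemma a_bounds: "\<Lambda>0 * (\<Sum>i\<in>S. (v i)\<^sup>2) \<le> qf S (a y) v" "qf S (a y) v \<le> \<Lambda>1 * (\<Sum>i\<in>S. (v i)\<^sup>2)"
  using setting unfolding setting_def qform_eq_qf by blast+

lemma a_holder: "i \<in> S \<Longrightarrow> j \<in> S \<Longrightarrow> k \<in> S \<Longrightarrow>
    \<bar>a (y(k := y k + h)) i j - a y i j\<bar> \<le> kappa_b * \<bar>h\<bar> powr \<alpha> * real k powr (- \<beta>)"
  using setting unfolding setting_def by blast

lemma g_has_integral: "i \<in> S \<Longrightarrow> ((\<lambda>s. (exp (- lam i * s))\<^sup>2) has_integral g i) {0..t}"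
  using integral_exp_neg[of "2 * lam i" t] lam_pos[of i] t
  by (simp add: gdiag_def exp_double[symmetric] mult.assoc)

lemma g_pos: "i \<in> S \<Longrightarrow> 0 < g i"
  using lam_pos[of i] t by (simp add: gdiag_def)

lemma g_le: "i \<in> S \<Longrightarrow> g i \<le> 1 / (2 * kappa_l * (real i)\<^sup>2)"
proof -
  assume i: "i \<in> S"
  have k: "0 < kappa_l * (real i)\<^sup>2" using kappa_l_pos i by (simp add: idx_def)
  have "g i \<le> 1 / (2 * lam i)"
    using lam_pos[OF i] by (simp add: gdiag_def divide_right_mono)
  also have "\<dots> \<le> 1 / (2 * kappa_l * (real i)\<^sup>2)"
    using lam_ge[OF i] k by (intro divide_left_mono) auto
  finally show ?thesis .
qed

text \<open>Adds the two bounds \<open>g i \<le> t\<close> and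
  \<open>g i * lam i \<le> 1 / 2\<close>, the latter multiplied by \<open>t\<close>; the factor 2
  rounds up 3/2.\<close>

lemma g_le_time: "i \<in> S \<Longrightarrow> g i \<le> 2 * t / (1 + lam i * t)"
proof -
  assume i: "i \<in> S"
  have l: "0 < lam i" by (rule lam_pos[OF i])
  have "1 - exp (- 2 * lam i * t) \<le> 2 * lam i * t"
    using exp_ge_add_one_self[of "- 2 * lam i * t"] by simp
  then have "g i \<le> t" using l by (simp add: gdiag_def field_simps)
  moreover have "g i * lam i \<le> 1 / 2" using l by (simp add: gdiag_def)
  then have "g i * lam i * t \<le> 1 / 2 * t" using t by (intro mult_right_mono) auto
  moreover have "g i * (1 + lam i * t) = g i + g i * lam i * t" by (simp add: distrib_left)
  ultimately have "g i * (1 + lam i * t) \<le> 2 * t" using t by linarith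
  moreover have "0 < 1 + lam i * t" using l t by (simp add: add_pos_pos)
  ultimately show ?thesis by (simp add: pos_le_divide_eq)
qed

definition kern :: "nat \<Rightarrow> nat \<Rightarrow> real" where
  "kern i j = integral {0..t} (\<lambda>s. exp (- (lam i + lam j) * s))"

lemma kern_has_integral: "i \<in> S \<Longrightarrow> j \<in> S \<Longrightarrow>
    ((\<lambda>s. exp (- lam i * s) * exp (- lam j * s)) has_integral kern i j) {0..t}"
  using integrable_integral[OF has_integral_integrable[OF integral_exp_neg[of "lam i + lam j" t]]]
    lam_pos[of i] lam_pos[of j] t
  by (simp add: kern_def exp_add[symmetric] algebra_simps)

lemma kern_nonneg: "i \<in> S \<Longrightarrow> j \<in> S \<Longrightarrow> 0 \<le> kern i j"
  by (rule has_integral_nonneg[OF kern_has_integral]) auto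

lemma a_t_eq: "a_t lam a y t i j = a y i j * kern i j"
  by (simp add: a_t_def kern_def)

text \<open>The form of \<open>a_t\<close> is the time integral of the form of \<open>a y\<close> at
  the vector \<open>exp (- lam i * s) * v i\<close>. Ellipticity can be used under the integral, and
  the squared norms integrate to the weights \<open>g i\<close>.\<close>

lemma qf_a_t_bounds:
  "\<Lambda>0 * (\<Sum>i\<in>S. (v i)\<^sup>2 * g i) \<le> qf S (a_t lam a y t) v"
  "qf S (a_t lam a y t) v \<le> \<Lambda>1 * (\<Sum>i\<in>S. (v i)\<^sup>2 * g i)"
proof -
  let ?v = "\<lambda>s i. exp (- lam i * s) * v i"
  have "((\<lambda>s. \<Sum>i\<in>S. \<Sum>j\<in>S. v i * a y i j * v j * (exp (- lam i * s) * exp (- lam j * s)))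
      has_integral (\<Sum>i\<in>S. \<Sum>j\<in>S. v i * a y i j * v j * kern i j)) {0..t}"
    by (intro has_integral_sum finite_idx has_integral_mult_right kern_has_integral)
  moreover have "(\<lambda>s. \<Sum>i\<in>S. \<Sum>j\<in>S. v i * a y i j * v j * (exp (- lam i * s) * exp (- lam j * s)))
      = (\<lambda>s. qf S (a y) (?v s))"
    unfolding qf_def by (simp only: mult_ac)
  moreover have "(\<Sum>i\<in>S. \<Sum>j\<in>S. v i * a y i j * v j * kern i j) = qf S (a_t lam a y t) v"
    unfolding qf_def a_t_eq by (simp only: mult_ac)
  ultimately have q: "((\<lambda>s. qf S (a y) (?v s)) has_integral qf S (a_t lam a y t) v) {0..t}"
    by (simp only:)
  have "((\<lambda>s. \<Sum>i\<in>S. (v i)\<^sup>2 * (exp (- lam i * s))\<^sup>2) has_integral (\<Sum>i\<in>S. (v i)\<^sup>2 * g i)) {0..t}"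
    by (intro has_integral_sum finite_idx has_integral_mult_right g_has_integral)
  moreover have "(\<lambda>s. \<Sum>i\<in>S. (v i)\<^sup>2 * (exp (- lam i * s))\<^sup>2) = (\<lambda>s. \<Sum>i\<in>S. (?v s i)\<^sup>2)"
    by (simp only: power_mult_distrib mult_ac)
  ultimately have "((\<lambda>s. \<Sum>i\<in>S. (?v s i)\<^sup>2) has_integral (\<Sum>i\<in>S. (v i)\<^sup>2 * g i)) {0..t}"
    by (simp only:)
  then have n: "((\<lambda>s. c * (\<Sum>i\<in>S. (?v s i)\<^sup>2)) has_integral c * (\<Sum>i\<in>S. (v i)\<^sup>2 * g i)) {0..t}" for c
    by (rule has_integral_mult_right)
  show "\<Lambda>0 * (\<Sum>i\<in>S. (v i)\<^sup>2 * g i) \<le> qf S (a_t lam a y t) v"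
    by (rule has_integral_le[OF n q]) (rule a_bounds)
  show "qf S (a_t lam a y t) v \<le> \<Lambda>1 * (\<Sum>i\<in>S. (v i)\<^sup>2 * g i)"
    by (rule has_integral_le[OF q n]) (rule a_bounds)
qed

lemma a_t_sym: "i \<in> S \<Longrightarrow> j \<in> S \<Longrightarrow> a_t lam a y t i j = a_t lam a y t j i"
  using a_sym[of i j y] by (simp add: a_t_def add.commute)

lemma pos_def_a_t: "pos_def S (a_t lam a y t)"
proof (rule pos_defI[OF a_t_sym])
  fix v :: "nat \<Rightarrow> real" and i assume i: "i \<in> S" "v i \<noteq> 0"
  then have "0 < (\<Sum>i\<in>S. (v i)\<^sup>2 * g i)"
    using g_pos by (intro sum_pos2[of S i]) (auto simp: less_imp_le)
  then have "0 < \<Lambda>0 * (\<Sum>i\<in>S. (v i)\<^sup>2 * g i)" using \<Lambda>0_pos by simp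
  also have "\<dots> \<le> qf S (a_t lam a y t) v" by (rule qf_a_t_bounds)
  finally show "0 < qf S (a_t lam a y t) v" .
qed auto

text \<open>The matrix g^(-1/2) a_t g^(-1/2), inverse to \<open>At_tilde\<close> and so the
  covariance in scaled coordinates. Its ellipticity constants are those of \<open>a\<close>,
  whatever \<open>t\<close> and \<open>K\<close>.\<close>

definition cov :: "(nat \<Rightarrow> real) \<Rightarrow> nat \<Rightarrow> nat \<Rightarrow> real" where
  "cov y i j = a_t lam a y t i j / (sqrt (g i) * sqrt (g j))"

lemma cov_sym: "i \<in> S \<Longrightarrow> j \<in> S \<Longrightarrow> cov y i j = cov y j i"
  using a_t_sym[of i j y] by (simp add: cov_def mult.commute)

lemma qf_cov_bounds:
  "\<Lambda>0 * (\<Sum>i\<in>S. (v i)\<^sup>2) \<le> qf S (cov y) v" "qf S (cov y) v \<le> \<Lambda>1 * (\<Sum>i\<in>S. (v i)\<^sup>2)"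
proof -
  let ?v = "\<lambda>i. v i / sqrt (g i)"
  have "qf S (cov y) v = qf S (a_t lam a y t) ?v"
    unfolding qf_def cov_def by simp
  moreover have "(\<Sum>i\<in>S. (?v i)\<^sup>2 * g i) = (\<Sum>i\<in>S. (v i)\<^sup>2)"
  proof (rule sum.cong)
    fix i assume "i \<in> S"
    then show "(?v i)\<^sup>2 * g i = (v i)\<^sup>2" using g_pos[of i] by (simp add: power_divide)
  qed simp
  ultimately show "\<Lambda>0 * (\<Sum>i\<in>S. (v i)\<^sup>2) \<le> qf S (cov y) v" "qf S (cov y) v \<le> \<Lambda>1 * (\<Sum>i\<in>S. (v i)\<^sup>2)"
    using qf_a_t_bounds(1)[where v = ?v and y = y] qf_a_t_bounds(2)[where v = ?v and y = y] by simp_all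
qed

lemma pos_def_cov: "pos_def S (cov y)"
  using \<Lambda>0_pos by (intro pos_defI_bound[of S \<Lambda>0] cov_sym qf_cov_bounds) auto

text \<open>Cauchy-Schwarz for the time integral, obtained by integrating
  \<open>weighted_AM_GM\<close> with the weights that balance its two terms.\<close>

lemma kern_le: "i \<in> S \<Longrightarrow> j \<in> S \<Longrightarrow> kern i j \<le> sqrt (g i) * sqrt (g j)"
proof -
  assume ij: "i \<in> S" "j \<in> S"
  let ?r = "sqrt (g i)" and ?s = "sqrt (g j)"
  have rs: "0 < ?r" "0 < ?s" "?r\<^sup>2 = g i" "?s\<^sup>2 = g j" using g_pos[OF ij(1)] g_pos[OF ij(2)] by auto
  have "((\<lambda>s. ?s / (2 * ?r) * (exp (- lam i * s))\<^sup>2 + ?r / (2 * ?s) * (exp (- lam j * s))\<^sup>2)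
      has_integral ?s / (2 * ?r) * g i + ?r / (2 * ?s) * g j) {0..t}"
    by (intro has_integral_add has_integral_mult_right g_has_integral ij)
  then have "kern i j \<le> ?s / (2 * ?r) * g i + ?r / (2 * ?s) * g j"
  proof (rule has_integral_le[OF kern_has_integral[OF ij]])
    fix s :: real
    show "exp (- lam i * s) * exp (- lam j * s)
      \<le> ?s / (2 * ?r) * (exp (- lam i * s))\<^sup>2 + ?r / (2 * ?s) * (exp (- lam j * s))\<^sup>2"
      by (rule weighted_AM_GM[OF rs(1,2)])
  qed
  also have "\<dots> = ?r * ?s"
  proof -
    have "v / (2 * u) * u\<^sup>2 + u / (2 * v) * v\<^sup>2 = u * v" if "0 < u" "0 < v" for u v :: real
      using that by (simp add: power2_eq_square)
    from this[OF rs(1,2)] show ?thesis by (simp only: rs(3,4))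
  qed
  finally show ?thesis .
qed

text \<open>Normalisation multiplies an entry of \<open>a\<close> by a factor in [0,1], so the
  Hoelder bound passes to \<open>cov\<close> with a constant free of \<open>t\<close> and
  \<open>lam\<close>.\<close>

lemma cov_diff_le:
  assumes "i \<in> S" "j \<in> S"
  shows "\<bar>cov y i j - cov y' i j\<bar> \<le> \<bar>a y i j - a y' i j\<bar>"
proof -
  let ?q = "kern i j / (sqrt (g i) * sqrt (g j))"
  have q: "0 \<le> ?q" "?q \<le> 1"
    using kern_nonneg[OF assms] kern_le[OF assms] g_pos[OF assms(1)] g_pos[OF assms(2)] by auto
  have "cov y i j - cov y' i j = (a y i j - a y' i j) * ?q"
    by (simp add: cov_def a_t_eq diff_divide_distrib left_diff_distrib)
  then have "\<bar>cov y i j - cov y' i j\<bar> = \<bar>a y i j - a y' i j\<bar> * ?q"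
    by (simp only: abs_mult abs_of_nonneg[OF q(1)])
  also have "\<dots> \<le> \<bar>a y i j - a y' i j\<bar> * 1" using q(2) by (rule mult_left_mono) simp
  finally show ?thesis by simp
qed

lemma QK_A_t: "distinct L \<Longrightarrow> set L = S \<Longrightarrow> QK K w (A_t K lam a y t) = gauss L w (a_t lam a y t)"
  unfolding A_t_def by (intro QK_eq_gauss pos_def_a_t invK_right_inverse)

lemma QK_At_tilde:
  assumes "distinct L" "set L = S"
  shows "QK K w (At_tilde K lam a y t) = gauss L w (cov y)"
proof (rule QK_eq_gauss[OF pos_def_cov assms])
  fix k l assume kl: "k \<in> S" "l \<in> S"
  have "(\<Sum>m\<in>S. cov y k m * At_tilde K lam a y t m l)
      = (\<Sum>m\<in>S. sqrt (g l) / sqrt (g k) * (a_t lam a y t k m * invK K (a_t lam a y t) m l))"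
  proof (rule sum.cong)
    fix m assume "m \<in> S"
    then have "sqrt (g m) \<noteq> 0" using g_pos[of m] by simp
    then show "cov y k m * At_tilde K lam a y t m l
      = sqrt (g l) / sqrt (g k) * (a_t lam a y t k m * invK K (a_t lam a y t) m l)"
      by (simp add: cov_def At_tilde_def A_t_def)
  qed simp
  also have "\<dots> = sqrt (g l) / sqrt (g k) * (if k = l then 1 else 0)"
    by (simp only: sum_distrib_left[symmetric] invK_right_inverse[OF pos_def_a_t kl])
  also have "\<dots> = (if k = l then 1 else 0)" using g_pos[OF kl(1)] g_pos[OF kl(2)] by simp
  finally show "(\<Sum>m\<in>S. cov y k m * At_tilde K lam a y t m l) = (if k = l then 1 else 0)" .
qed

text \<open>The point \<open>y = x' + w\<close> at which \<open>a\<close> is evaluated. Elements of the product space take the value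
  \<open>undefined\<close> outside \<open>S\<close>, which \<open>a\<close> may depend on; \<open>z\<close> records the coordinates outside \<open>S\<close>.\<close>

definition pt :: "(nat \<Rightarrow> real) \<Rightarrow> (nat \<Rightarrow> real) \<Rightarrow> (nat \<Rightarrow> real) \<Rightarrow> (nat \<Rightarrow> real) \<Rightarrow> nat \<Rightarrow> real" where
  "pt d x z w = (\<lambda>i. if i \<in> S then xprime lam t x i + d i * w i else z i)"

lemma pt_upd: "k \<in> S \<Longrightarrow> pt d x z (w(k := s)) = (pt d x z w)(k := pt d x z w k + d k * (s - w k))"
  by (auto simp: pt_def fun_eq_iff algebra_simps)

lemma pt_cong: "(\<And>i. i \<in> S \<Longrightarrow> d i * w i = d' i * w' i) \<Longrightarrow> pt d x z w = pt d' x z w'"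
  by (auto simp: pt_def)

lemma pt_zero_outside: "pt d x z (zero_outside S w) = pt d x z w"
  by (intro pt_cong) (simp add: zero_outside_def)

lemma borel_measurable_a_pt:
  assumes "i \<in> S" "j \<in> S" "0 < \<alpha>"
  shows "(\<lambda>w. a (pt d x z w) i j) \<in> borel_measurable (PiM UNIV (\<lambda>_. borel))"
proof -
  have "continuous_on UNIV (\<lambda>w. a (pt d x z w) i j)"
  proof (rule continuous_on_coordinatewise_holder[OF finite_idx assms(3),
        where C = "\<lambda>k. kappa_b * \<bar>d k\<bar> powr \<alpha> * real k powr (- \<beta>)"])
    fix w :: "nat \<Rightarrow> real" and k s assume "k \<in> S"
    then have "\<bar>a (pt d x z (w(k := s))) i j - a (pt d x z w) i j\<bar>
      \<le> kappa_b * \<bar>d k * (s - w k)\<bar> powr \<alpha> * real k powr (- \<beta>)"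
      unfolding pt_upd[OF \<open>k \<in> S\<close>] using assms by (intro a_holder)
    also have "\<bar>d k * (s - w k)\<bar> powr \<alpha> = \<bar>d k\<bar> powr \<alpha> * \<bar>s - w k\<bar> powr \<alpha>"
      by (simp add: abs_mult powr_mult)
    finally show "\<bar>a (pt d x z (w(k := s))) i j - a (pt d x z w) i j\<bar>
      \<le> kappa_b * \<bar>d k\<bar> powr \<alpha> * real k powr (- \<beta>) * \<bar>s - w k\<bar> powr \<alpha>"
      by (simp only: mult_ac)
  next
    fix w w' :: "nat \<Rightarrow> real" assume "\<And>k. k \<in> S \<Longrightarrow> w k = w' k"
    then have "pt d x z w = pt d x z w'" by (intro pt_cong) simp
    then show "a (pt d x z w) i j = a (pt d x z w') i j" by simp
  qed
  then show ?thesis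
    \<comment> \<open>Over the countable index type \<open>nat\<close> the product sigma-algebra is
      the Borel one of the product topology.\<close>
    unfolding measurable_cong_sets[OF sets_PiM_equal_borel refl]
    by (rule borel_measurable_continuous_onI)
qed

lemma borel_measurable_a_t_pt:
  assumes "i \<in> S" "j \<in> S" "0 < \<alpha>"
  shows "(\<lambda>w. a_t lam a (pt d x z w) t i j) \<in> borel_measurable (PiM UNIV (\<lambda>_. borel))"
  unfolding a_t_eq by (intro borel_measurable_times borel_measurable_a_pt assms borel_measurable_const)

lemma borel_measurable_cov_pt:
  assumes "i \<in> S" "j \<in> S" "0 < \<alpha>"
  shows "(\<lambda>w. cov (pt d x z w) i j) \<in> borel_measurable (PiM UNIV (\<lambda>_. borel))"
  unfolding cov_def by (intro borel_measurable_divide borel_measurable_a_t_pt assms borel_measurable_const)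

abbreviation "scl \<equiv> \<lambda>i. sqrt (g i)"

text \<open>A displacement of \<open>w m\<close> moves the argument of \<open>a\<close> by
  \<open>sqrt (g m)\<close> times as much, and \<open>sqrt (g m)\<close> is O(1/m) because
  \<open>lam m\<close> grows quadratically. The radius \<open>real m powr (3/4)\<close> leaves the
  exponent -1/4, which the Hoelder condition multiplies by \<open>\<alpha>\<close>.\<close>

lemma cov_pt_diff_le:
  assumes al: "0 < \<alpha>" "\<alpha> \<le> 1" and be: "7/2 - \<alpha>/2 < \<beta>"
    and m: "m \<in> S" and kl: "k \<in> S" "l \<in> S" and w: "\<bar>w m\<bar> \<le> real m powr (3/4)"
  shows "\<bar>cov (pt scl x z w) k l - cov (pt scl x z (w(m := 0))) k l\<bar>
    \<le> \<bar>kappa_b\<bar> * (1 / (2 * kappa_l)) powr (\<alpha>/2) * real m powr (- (13/4))"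
proof -
  have m1: "1 \<le> real m" using m by (simp add: idx_def)
  let ?q = "1 / (2 * kappa_l)"
  have q: "0 < ?q" using kappa_l_pos by simp
  have "g m \<le> ?q / (real m)\<^sup>2" using g_le[OF m] by simp
  then have "sqrt (g m) \<le> sqrt (?q / (real m)\<^sup>2)" by (rule real_sqrt_le_mono)
  also have "\<dots> = ?q powr (1/2) * real m powr (- 1)"
    using q m1 by (simp add: real_sqrt_divide real_sqrt_mult powr_half_sqrt powr_minus_divide)
  finally have sg: "sqrt (g m) \<le> ?q powr (1/2) * real m powr (- 1)" .
  have "\<bar>sqrt (g m) * (0 - w m)\<bar> = sqrt (g m) * \<bar>w m\<bar>"
    using g_pos[OF m] by (simp add: abs_mult)
  also have "\<dots> \<le> (?q powr (1/2) * real m powr (- 1)) * real m powr (3/4)"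
    using g_pos[OF m] by (intro mult_mono sg w) auto
  also have "\<dots> = ?q powr (1/2) * real m powr (- (1/4))"
    by (simp only: mult.assoc powr_add[symmetric]) simp
  finally have "\<bar>sqrt (g m) * (0 - w m)\<bar> powr \<alpha> \<le> (?q powr (1/2) * real m powr (- (1/4))) powr \<alpha>"
    using al by (intro powr_mono2) auto
  also have "\<dots> = ?q powr (\<alpha>/2) * real m powr (- (\<alpha>/4))"
    by (simp add: powr_mult powr_powr)
  finally have step: "\<bar>sqrt (g m) * (0 - w m)\<bar> powr \<alpha> \<le> ?q powr (\<alpha>/2) * real m powr (- (\<alpha>/4))" .
  have "\<bar>cov (pt scl x z w) k l - cov (pt scl x z (w(m := 0))) k l\<bar>
    \<le> \<bar>a (pt scl x z w) k l - a (pt scl x z (w(m := 0))) k l\<bar>"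
    by (rule cov_diff_le[OF kl])
  also have "\<dots> = \<bar>a (pt scl x z (w(m := 0))) k l - a (pt scl x z w) k l\<bar>"
    by (rule abs_minus_commute)
  also have "\<dots> \<le> kappa_b * \<bar>sqrt (g m) * (0 - w m)\<bar> powr \<alpha> * real m powr (- \<beta>)"
    unfolding pt_upd[OF m] by (rule a_holder[OF kl m])
  \<comment> \<open>The sign of \<open>kappa_b\<close> is not prescribed; the absolute value keeps
    the uniform constant nonnegative.\<close>
  also have "\<dots> \<le> \<bar>kappa_b\<bar> * (?q powr (\<alpha>/2) * real m powr (- (\<alpha>/4))) * real m powr (- \<beta>)"
    by (intro mult_right_mono mult_mono step) auto
  also have "\<dots> = \<bar>kappa_b\<bar> * ?q powr (\<alpha>/2) * real m powr (- (\<alpha>/4) + - \<beta>)"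
    by (simp only: powr_add mult_ac)
  \<comment> \<open>The bound on \<open>\<beta>\<close> gives
    \<open>- \<alpha>/4 - \<beta> < \<alpha>/4 - 7/2\<close>, which is at most -13/4 since
    \<open>\<alpha> \<le> 1\<close>.\<close>
  also have "\<dots> \<le> \<bar>kappa_b\<bar> * ?q powr (\<alpha>/2) * real m powr (- (13/4))"
    using m1 al be by (intro mult_left_mono powr_mono) auto
  finally show ?thesis .
qed

section \<open>Both integrals of the theorem in terms of \<open>moment_int\<close>\<close>

lemma moment_int_cov_eq:
  assumes "set L = S"
  shows "moment_int j p (\<lambda>w. cov (pt scl x z w)) L 1
    = (\<integral>\<^sup>+w. ennreal (\<bar>w j\<bar> powr (2 * p) * gauss L w (cov (pt scl x z w))) \<partial>(PiM S (\<lambda>_. lborel)))"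
  unfolding moment_int_def assms by (simp add: pt_zero_outside)

lemma nn_integral_QK_At_tilde:
  assumes L: "distinct L" "set L = S"
  shows "(\<integral>\<^sup>+w. ennreal (\<bar>w j\<bar> powr (2 * p)
      * QK K w (At_tilde K lam a (\<lambda>i. xprime lam t x i + sqrt (g i) * w i) t)) \<partial>(PiM S (\<lambda>_. lborel)))
    = moment_int j p (\<lambda>w. cov (pt scl x (\<lambda>i. xprime lam t x i + sqrt (g i) * undefined) w)) L 1"
  unfolding moment_int_cov_eq[OF L(2)] QK_At_tilde[OF L]
proof (rule nn_integral_cong)
  fix w assume "w \<in> space (PiM S (\<lambda>_. lborel :: real measure))"
  then have "w i = undefined" if "i \<notin> S" for i
    using that by (auto simp: space_PiM PiE_def extensional_def)
  then have "(\<lambda>i. xprime lam t x i + sqrt (g i) * w i)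
    = pt scl x (\<lambda>i. xprime lam t x i + sqrt (g i) * undefined) w"
    by (auto simp: pt_def)
  then show "ennreal (\<bar>w j\<bar> powr (2 * p) * gauss L w (cov (\<lambda>i. xprime lam t x i + sqrt (g i) * w i)))
    = ennreal (\<bar>w j\<bar> powr (2 * p)
      * gauss L w (cov (pt scl x (\<lambda>i. xprime lam t x i + sqrt (g i) * undefined) w)))"
    by simp
qed

lemma gauss_cov_eq:
  assumes L: "distinct L" "set L = S"
  shows "gauss L w (cov y) = (\<Prod>i\<in>S. sqrt (g i)) * gauss L (\<lambda>i\<in>S. sqrt (g i) * w i) (a_t lam a y t)"
proof -
  \<comment> \<open>The value 1 off \<open>S\<close> ensures positivity at every index, as
    \<open>gauss_rescale\<close> asks.\<close>
  define c where "c i = (if i \<in> S then sqrt (g i) else 1)" for i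
  have c: "0 < c i" for i using g_pos[of i] by (simp add: c_def)
  have "gauss L w (cov y) = prod_list (map c L) * gauss L (\<lambda>k. c k * w k) (\<lambda>k l. c k * c l * cov y k l)"
    by (rule gauss_rescale[OF c])
  also have "prod_list (map c L) = (\<Prod>i\<in>S. sqrt (g i))"
    using prod.distinct_set_conv_list[OF L(1), of c] L(2) by (simp add: c_def)
  also have "gauss L (\<lambda>k. c k * w k) (\<lambda>k l. c k * c l * cov y k l)
    = gauss L (\<lambda>i\<in>S. sqrt (g i) * w i) (a_t lam a y t)"
  proof (rule gauss_cong)
    fix i assume "i \<in> set L"
    then show "c i * w i = (\<lambda>i\<in>S. sqrt (g i) * w i) i" using L(2) by (simp add: c_def)
  next
    fix i j assume "i \<in> set L" "j \<in> set L"
    then have ij: "i \<in> S" "j \<in> S" using L(2) by auto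
    have "sqrt (g i) * sqrt (g j) \<noteq> 0" using g_pos[OF ij(1)] g_pos[OF ij(2)] by simp
    then show "c i * c j * cov y i j = a_t lam a y t i j" using ij by (simp add: c_def cov_def)
  qed
  finally show ?thesis .
qed

text \<open>Under w = g^(1/2) w' the Jacobian cancels against the normalisation of the density, and
  the moment factor releases \<open>g j powr p\<close>. Outside \<open>S\<close> the point
  \<open>y\<close> is recorded by another \<open>z\<close> than in the scaled integral, so the two
  \<open>moment_int\<close> terms need not coincide.\<close>

lemma nn_integral_QK_A_t:
  assumes L: "distinct L" "set L = S" and j: "j \<in> S" and al: "0 < \<alpha>"
  shows "(\<integral>\<^sup>+w. ennreal (\<bar>w j\<bar> powr (2 * p)
      * QK K w (A_t K lam a (\<lambda>i. xprime lam t x i + w i) t)) \<partial>(PiM S (\<lambda>_. lborel)))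
    = ennreal (g j powr p) * moment_int j p (\<lambda>w. cov (pt scl x (\<lambda>i. xprime lam t x i + undefined) w)) L 1"
proof -
  let ?z = "\<lambda>i. xprime lam t x i + undefined"
  define P where "P = (\<Prod>i\<in>S. sqrt (g i))"
  define f where "f w = ennreal (\<bar>w j\<bar> powr (2 * p) * gauss L w (a_t lam a (pt (\<lambda>_. 1) x ?z w) t))" for w
  have P: "0 < P" unfolding P_def using g_pos by (intro prod_pos) auto
  have "(\<integral>\<^sup>+w. ennreal (\<bar>w j\<bar> powr (2 * p)
      * QK K w (A_t K lam a (\<lambda>i. xprime lam t x i + w i) t)) \<partial>(PiM S (\<lambda>_. lborel)))
    = (\<integral>\<^sup>+w. f w \<partial>(PiM S (\<lambda>_. lborel)))"
    unfolding QK_A_t[OF L]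
  proof (rule nn_integral_cong)
    fix w assume "w \<in> space (PiM S (\<lambda>_. lborel :: real measure))"
    then have "w i = undefined" if "i \<notin> S" for i
      using that by (auto simp: space_PiM PiE_def extensional_def)
    then have "(\<lambda>i. xprime lam t x i + w i) = pt (\<lambda>_. 1) x ?z w"
      by (auto simp: pt_def)
    then show "ennreal (\<bar>w j\<bar> powr (2 * p) * gauss L w (a_t lam a (\<lambda>i. xprime lam t x i + w i) t)) = f w"
      by (simp add: f_def)
  qed
  also have "\<dots> = ennreal P * (\<integral>\<^sup>+w. f (\<lambda>i\<in>S. sqrt (g i) * w i) \<partial>(PiM S (\<lambda>_. lborel)))"
    unfolding P_def
  proof (rule nn_integral_PiM_scale)
    have "(\<lambda>w. \<bar>w j\<bar> powr (2 * p) * gauss L w (\<lambda>k l. 1 * a_t lam a (pt (\<lambda>_. 1) x ?z (zero_outside S w)) t k l))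
      \<in> borel_measurable (PiM S (\<lambda>_. lborel))"
      using al L j by (intro borel_measurable_moment_integrand borel_measurable_a_t_pt) auto
    then show "f \<in> borel_measurable (PiM S (\<lambda>_. lborel))"
      by (simp add: f_def[abs_def] pt_zero_outside)
  qed (use g_pos in auto)
  also have "(\<integral>\<^sup>+w. f (\<lambda>i\<in>S. sqrt (g i) * w i) \<partial>(PiM S (\<lambda>_. lborel)))
    = (\<integral>\<^sup>+w. ennreal (g j powr p / P)
      * ennreal (\<bar>w j\<bar> powr (2 * p) * gauss L w (cov (pt scl x ?z w))) \<partial>(PiM S (\<lambda>_. lborel)))"
  proof (rule nn_integral_cong)
    fix w :: "nat \<Rightarrow> real"
    let ?r = "\<lambda>i\<in>S. sqrt (g i) * w i"
    have pt: "pt (\<lambda>_. 1) x ?z ?r = pt scl x ?z w" by (intro pt_cong) simp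
    let ?W = "\<bar>w j\<bar> powr (2 * p)" and ?G = "gauss L ?r (a_t lam a (pt scl x ?z w) t)"
    have rj: "\<bar>?r j\<bar> powr (2 * p) = ?W * g j powr p"
    proof -
      have "sqrt (g j) powr (2 * p) = g j powr p"
        using g_pos[OF j] by (simp add: powr_half_sqrt[symmetric] powr_powr)
      then show ?thesis using j g_pos[OF j] by (simp add: abs_mult powr_mult)
    qed
    have gb: "gauss L w (cov (pt scl x ?z w)) = P * ?G"
      unfolding P_def by (rule gauss_cov_eq[OF L])
    have cancel: "u * v * c = v / P * (u * (P * c))" for u v c :: real
      using P by simp
    have "f ?r = ennreal (?W * g j powr p * ?G)" by (simp only: f_def pt rj)
    also have "\<dots> = ennreal (g j powr p / P * (?W * gauss L w (cov (pt scl x ?z w))))"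
      unfolding gb cancel[of ?W "g j powr p" ?G] by (rule refl)
    also have "\<dots> = ennreal (g j powr p / P)
        * ennreal (\<bar>w j\<bar> powr (2 * p) * gauss L w (cov (pt scl x ?z w)))"
      using P by (intro ennreal_mult mult_nonneg_nonneg gauss_nonneg divide_nonneg_nonneg) auto
    finally show "f ?r = ennreal (g j powr p / P)
        * ennreal (\<bar>w j\<bar> powr (2 * p) * gauss L w (cov (pt scl x ?z w)))" .
  qed
  also have "\<dots> = ennreal (g j powr p / P) * (\<integral>\<^sup>+w. ennreal (\<bar>w j\<bar> powr (2 * p)
      * gauss L w (cov (pt scl x ?z w))) \<partial>(PiM S (\<lambda>_. lborel)))"
  proof (rule nn_integral_cmult)
    have "(\<lambda>w. \<bar>w j\<bar> powr (2 * p) * gauss L w (\<lambda>k l. 1 * cov (pt scl x ?z (zero_outside S w)) k l))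
      \<in> borel_measurable (PiM S (\<lambda>_. lborel))"
      using al L j by (intro borel_measurable_moment_integrand borel_measurable_cov_pt) auto
    then show "(\<lambda>w. ennreal (\<bar>w j\<bar> powr (2 * p) * gauss L w (cov (pt scl x ?z w))))
      \<in> borel_measurable (PiM S (\<lambda>_. lborel))"
      by (simp add: pt_zero_outside)
  qed
  also have "ennreal P * (ennreal (g j powr p / P) * (\<integral>\<^sup>+w. ennreal (\<bar>w j\<bar> powr (2 * p)
      * gauss L w (cov (pt scl x ?z w))) \<partial>(PiM S (\<lambda>_. lborel))))
    = ennreal (g j powr p) * moment_int j p (\<lambda>w. cov (pt scl x ?z w)) L 1"
  proof -
    have "ennreal P * ennreal (g j powr p / P) = ennreal (g j powr p)"
      using P by (simp add: ennreal_mult[symmetric])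
    then show ?thesis unfolding moment_int_cov_eq[OF L(2)] by (simp only: mult.assoc[symmetric])
  qed
  finally show ?thesis .
qed

end

theorem theorem5p12:
  fixes \<Lambda>0 \<Lambda>1 kappa_l kappa_b kappa_g \<alpha> \<beta> \<gamma> p :: real
  assumes "0 < \<Lambda>0" "\<Lambda>0 \<le> \<Lambda>1" "0 < kappa_l"
    and "\<gamma> > 3/2" and "1/2 < \<alpha>" "\<alpha> \<le> 1" and "p \<ge> 0"
    and "\<beta> > max (max (2 - \<alpha>/2 + p) (7/2 - \<alpha>/2)) (3 - \<alpha>)"
  shows "\<exists>c1. \<forall>K::nat. \<forall>lam a.
     K \<ge> 1 \<longrightarrow> setting K \<Lambda>0 \<Lambda>1 kappa_l kappa_b \<alpha> \<beta> lam a \<longrightarrow>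
     (\<forall>y. \<forall>i\<in>idx K. \<forall>j\<in>idx K. \<bar>a y i j\<bar> \<le> kappa_g / (1 + \<bar>real i - real j\<bar> powr \<gamma>)) \<longrightarrow>
     (\<forall>j\<in>idx K. \<forall>t>0. \<forall>x::nat \<Rightarrow> real.
        (\<integral>\<^sup>+ w'. ennreal (\<bar>w' j\<bar> powr (2 * p) *
            QK K w' (At_tilde K lam a
               (\<lambda>i. xprime lam t x i + sqrt (gdiag lam t i) * w' i) t))
          \<partial>(PiM (idx K) (\<lambda>_. lborel))) \<le> ennreal c1
      \<and> (\<integral>\<^sup>+ w. ennreal (\<bar>w j\<bar> powr (2 * p) *
            QK K w (A_t K lam a (\<lambda>i. xprime lam t x i + w i) t))
          \<partial>(PiM (idx K) (\<lambda>_. lborel)))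
          \<le> ennreal (c1 * t powr p / (1 + lam j * t) powr p)
      \<and> c1 * t powr p / (1 + lam j * t) powr p \<le> c1 * t powr p)"
proof -
  have al: "0 < \<alpha>" "\<alpha> \<le> 1" and be: "7/2 - \<alpha>/2 < \<beta>" using assms(5,6,8) by auto
  have eta: "0 \<le> \<bar>kappa_b\<bar> * (1 / (2 * kappa_l)) powr (\<alpha>/2)" by simp
  from moment_int_bounded[OF assms(1,2,7) eta]
  obtain c0 where c0: "0 \<le> c0" and bound:
    "\<And>K j B. j \<in> idx K \<Longrightarrow>
      (\<And>k l. k \<in> idx K \<Longrightarrow> l \<in> idx K \<Longrightarrow> (\<lambda>w. B w k l) \<in> borel_measurable (PiM UNIV (\<lambda>_. borel))) \<Longrightarrow>
      (\<And>w k l. k \<in> idx K \<Longrightarrow> l \<in> idx K \<Longrightarrow> B w k l = B w l k) \<Longrightarrow>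
      (\<And>w v. \<Lambda>0 * (\<Sum>k\<in>idx K. (v k)\<^sup>2) \<le> qf (idx K) (B w) v) \<Longrightarrow>
      (\<And>w v. qf (idx K) (B w) v \<le> \<Lambda>1 * (\<Sum>k\<in>idx K. (v k)\<^sup>2)) \<Longrightarrow>
      (\<And>w m k l. m \<in> idx K \<Longrightarrow> k \<in> idx K \<Longrightarrow> l \<in> idx K \<Longrightarrow> \<bar>w m\<bar> \<le> real m powr (3/4) \<Longrightarrow>
        \<bar>B w k l - B (w(m := 0)) k l\<bar>
          \<le> \<bar>kappa_b\<bar> * (1 / (2 * kappa_l)) powr (\<alpha>/2) * real m powr (- (13/4))) \<Longrightarrow>
      moment_int j p B (j # sorted_list_of_set (idx K - {j})) 1 \<le> ennreal c0"
    by blast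
  \<comment> \<open>The factor \<open>2 powr p\<close> comes from the 2 in \<open>g_le_time\<close>;
    being at least 1, it keeps the first estimate valid as well.\<close>
  define c1 where "c1 = 2 powr p * c0"
  have "1 \<le> (2::real) powr p" using assms(7) by (simp add: ge_one_powr_ge_zero)
  then have c01: "c0 \<le> c1" "0 \<le> c1" using c0 mult_right_mono[of 1 "2 powr p" c0] by (auto simp: c1_def)
  show ?thesis
  proof (intro exI[of _ c1] allI impI ballI conjI)
    fix K :: nat and lam a j and t :: real and x :: "nat \<Rightarrow> real"
    assume set: "setting K \<Lambda>0 \<Lambda>1 kappa_l kappa_b \<alpha> \<beta> lam a" and j: "j \<in> idx K" and t: "0 < t"
    interpret ou_covariance K \<Lambda>0 \<Lambda>1 kappa_l kappa_b \<alpha> \<beta> lam a t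
      by (rule ou_covariance.intro[OF set t])
    let ?L = "j # sorted_list_of_set (idx K - {j})"
    have L: "distinct ?L" "set ?L = idx K" using j by auto
    \<comment> \<open>Uniform in \<open>z\<close>, hence applicable to both integrals despite their
      different values outside the index set.\<close>
    have m: "moment_int j p (\<lambda>w. cov (pt scl x z w)) ?L 1 \<le> ennreal c0" for z
      by (rule bound[OF j borel_measurable_cov_pt[OF _ _ al(1)] cov_sym qf_cov_bounds cov_pt_diff_le[OF al be]])
    show "(\<integral>\<^sup>+ w'. ennreal (\<bar>w' j\<bar> powr (2 * p) *
            QK K w' (At_tilde K lam a
               (\<lambda>i. xprime lam t x i + sqrt (gdiag lam t i) * w' i) t))
          \<partial>(PiM (idx K) (\<lambda>_. lborel))) \<le> ennreal c1"
      unfolding nn_integral_QK_At_tilde[OF L] using m ennreal_leI[OF c01(1)] by (rule order_trans)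
    have l: "0 < lam j" by (rule lam_pos[OF j])
    have den: "1 \<le> 1 + lam j * t" using l t by simp
    have "g j powr p \<le> (2 * t / (1 + lam j * t)) powr p"
      using g_pos[OF j] g_le_time[OF j] assms(7) by (intro powr_mono2) auto
    also have "\<dots> = 2 powr p * t powr p / (1 + lam j * t) powr p"
      using t den by (simp add: powr_divide powr_mult)
    finally have gp: "g j powr p * c0 \<le> c1 * t powr p / (1 + lam j * t) powr p"
      using mult_right_mono[OF _ c0] by (fastforce simp: c1_def mult_ac)
    have "ennreal (g j powr p) * moment_int j p (\<lambda>w. cov (pt scl x z w)) ?L 1
        \<le> ennreal (g j powr p * c0)" for z
      using mult_left_mono[OF m[of z], of "ennreal (g j powr p)"] c0 by (simp add: ennreal_mult)
    then have "ennreal (g j powr p) * moment_int j p (\<lambda>w. cov (pt scl x z w)) ?L 1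
        \<le> ennreal (c1 * t powr p / (1 + lam j * t) powr p)" for z
      using ennreal_leI[OF gp] by (rule order_trans)
    then show "(\<integral>\<^sup>+ w. ennreal (\<bar>w j\<bar> powr (2 * p) *
            QK K w (A_t K lam a (\<lambda>i. xprime lam t x i + w i) t))
          \<partial>(PiM (idx K) (\<lambda>_. lborel)))
          \<le> ennreal (c1 * t powr p / (1 + lam j * t) powr p)"
      unfolding nn_integral_QK_A_t[OF L j al(1)] .
    have "1 \<le> (1 + lam j * t) powr p" using den assms(7) by (rule ge_one_powr_ge_zero)
    then have "c1 * t powr p / (1 + lam j * t) powr p \<le> c1 * t powr p / 1"
      using c01(2) by (intro divide_left_mono) auto
    then show "c1 * t powr p / (1 + lam j * t) powr p \<le> c1 * t powr p" by simp
  qed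
qed

end
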